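(* Let $k$ be an algebraically closed field of characteristic zero, let $d_n\ge\dots\ge d_1\ge 2$ be integers, let $I=\langle x_1^{d_1},\dots,x_n^{d_n}\rangle\subset R=k[x_1,\dots,x_n]$ be an artinian monomial complete intersection, and let $e=d_1+\dots+d_n-n$ be the socle degree of $R/I$. For a linear form $\ell=a_1x_1+a_2x_2+\dots+a_nx_n$ with $a_1,\dots,a_n\in k$ the following holds. (1) If $d_n>\lfloor\frac{e+1}{2}\rfloor$, then $\ell$ is a Lefschetz element of $R/I$ if and only if $a_n\ne 0$. (2) If $e$ is even and $d_n\le\lfloor\frac{e+1}{2}\rfloor$, then $\ell$ is a Lefschetz element of $R/I$ if and only if $a_i=0$ for at most one index $i$ and $a_j\neq 0$ for all indices $j$ with $d_j>2$. (3) If $e$ is odd and $d_n\le\lfloor\frac{e+1}{2}\rfloor$, then $\ell$ is a Lefschetz element of $R/I$ if and only if $a_1a_2\cdots a_n\neq 0$.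
   Context: For a graded artinian algebra $A=R/I$, a linear form $\ell$ is a (weak) Lefschetz element of $A$ if for every integer $i$ the multiplication map $\times\ell:[A]_i\to[A]_{i+1}$ has maximal rank, i.e. is injective or surjective. Here $[A]_i$ denotes the degree $i$ component of $A$.
   Formalization: In (1), the "only if" direction (Lefschetz implies a_n ≠ 0) is proved except when n = 2 and d_1 = d_2, where it is false: x_1 is a Lefschetz element of k[x_1,x_2]/(x_1^d, x_2^d) although a_2 = 0. *)

theory Defs
  imports
    "HOL-Library.Poly_Mapping"
    "HOL-Computational_Algebra.Polynomial"
    "HOL-Algebra.QuotRing"
begin

text \<open>
  A polynomial is a finitely supported map from exponent vectors to coefficients, and an
  exponent vector is a finitely supported map from indices of variables to exponents; the
  product of \<^typ>\<open>(nat \<Rightarrow>\<^sub>0 nat) \<Rightarrow>\<^sub>0 'k\<close> is convolution.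
\<close>

type_synonym 'k mpoly = "(nat \<Rightarrow>\<^sub>0 nat) \<Rightarrow>\<^sub>0 'k"

definition Var :: "nat \<Rightarrow> 'k::comm_ring_1 mpoly" where
  "Var i = Poly_Mapping.single (Poly_Mapping.single i 1) 1"

definition Const :: "'k \<Rightarrow> 'k::comm_ring_1 mpoly" where
  "Const c = Poly_Mapping.single 0 c"

definition mdegree :: "(nat \<Rightarrow>\<^sub>0 nat) \<Rightarrow> nat" where
  "mdegree m = (\<Sum>i\<in>Poly_Mapping.keys m. Poly_Mapping.lookup m i)"

text \<open>\<open>poly_ring n\<close> is $k[x_1, \dots, x_n]$: only the variables with indices from 1 to \<open>n\<close> occur.\<close>

definition poly_ring :: "nat \<Rightarrow> 'k::comm_ring_1 mpoly ring" where
  "poly_ring n =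
    \<lparr>carrier = {p. \<forall>m\<in>Poly_Mapping.keys p. Poly_Mapping.keys m \<subseteq> {1..n}},
     monoid.mult = (*), one = 1, zero = 0, add = (+)\<rparr>"

definition linear_form :: "nat \<Rightarrow> (nat \<Rightarrow> 'k) \<Rightarrow> 'k::comm_ring_1 mpoly" where
  "linear_form n a = (\<Sum>i=1..n. Const (a i) * Var i)"

definition monomial_ci :: "nat \<Rightarrow> (nat \<Rightarrow> nat) \<Rightarrow> 'k::comm_ring_1 mpoly set" where
  "monomial_ci n d = Idl\<^bsub>poly_ring n\<^esub> ((\<lambda>i. Var i ^ d i) ` {1..n})"

text \<open>
  Degrees are integers; since 0 is homogeneous of every degree, the components of negative
  degree are zero.
\<close>

definition homogeneous_polys :: "nat \<Rightarrow> int \<Rightarrow> 'k::comm_ring_1 mpoly set" where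
  "homogeneous_polys n j =
    {p \<in> carrier (poly_ring n). \<forall>m\<in>Poly_Mapping.keys p. int (mdegree m) = j}"

text \<open>\<open>graded_component n I j\<close> is $[R/I]_j$, meant for homogeneous ideals \<open>I\<close> of \<open>poly_ring n\<close>.\<close>

definition graded_component ::
    "nat \<Rightarrow> 'k::comm_ring_1 mpoly set \<Rightarrow> int \<Rightarrow> 'k mpoly set set" where
  "graded_component n I j = (\<lambda>p. I +>\<^bsub>poly_ring n\<^esub> p) ` homogeneous_polys n j"

definition lefschetz_element ::
    "nat \<Rightarrow> 'k::comm_ring_1 mpoly set \<Rightarrow> 'k mpoly \<Rightarrow> bool" where
  "lefschetz_element n I l \<longleftrightarrow>
    (\<forall>j. let A = poly_ring n Quot I;
             mult_l = (\<lambda>u. (I +>\<^bsub>poly_ring n\<^esub> l) \<otimes>\<^bsub>A\<^esub> u)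
         in inj_on mult_l (graded_component n I j) \<or>
            mult_l ` graded_component n I j = graded_component n I (j + 1))"

lemma cring_poly_ring: "cring (poly_ring n :: 'k::comm_ring_1 mpoly ring)"
proof (rule cringI)
  show "abelian_group (poly_ring n :: 'k mpoly ring)"
  proof (rule abelian_groupI)
    fix x :: "'k mpoly" assume "x \<in> carrier (poly_ring n)"
    then show "\<exists>y\<in>carrier (poly_ring n). y \<oplus>\<^bsub>poly_ring n\<^esub> x = \<zero>\<^bsub>poly_ring n\<^esub>"
      by (intro bexI[of _ "- x"]) (auto simp: poly_ring_def in_keys_iff)
  qed (use Poly_Mapping.keys_add in \<open>fastforce simp: poly_ring_def add_ac\<close>)+
  show "comm_monoid (poly_ring n :: 'k mpoly ring)"
  proof (rule comm_monoidI)
    fix x y :: "'k mpoly"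
    assume "x \<in> carrier (poly_ring n)" "y \<in> carrier (poly_ring n)"
    moreover have "Poly_Mapping.keys (a + b) \<subseteq> Poly_Mapping.keys a \<union> Poly_Mapping.keys b"
      for a b :: "nat \<Rightarrow>\<^sub>0 nat" by (rule Poly_Mapping.keys_add)
    ultimately show "x \<otimes>\<^bsub>poly_ring n\<^esub> y \<in> carrier (poly_ring n)"
      using keys_mult[of x y] unfolding poly_ring_def by simp blast
  qed (auto simp: poly_ring_def mult_ac)
qed (auto simp: poly_ring_def algebra_simps)

end

theory Submission
  imports Defs
begin

text \<open>
  Write \<open>A\<close> for the quotient ring, \<open>e\<close> for its socle degree, \<open>S\<close> for the set of indices \<open>i\<close> with
  \<open>a i \<noteq> 0\<close>, \<open>e\<^sub>S\<close> for the sum of \<open>d i - 1\<close> over \<open>S\<close>, and put \<open>e\<^sub>T = e - e\<^sub>S\<close>. The algebra \<open>A\<close> is the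
  tensor product of the factors \<open>k[x]/(x^d)\<close>, and \<open>\<ell>\<close> sees only those with index in \<open>S\<close>. The other
  variables merely shift degrees, by every number from \<open>0\<close> to \<open>e\<^sub>T\<close>. The \<open>S\<close>-degree is the degree with
  respect to the variables with index in \<open>S\<close>.

  \<^bold>\<open>Maximal rank from \<open>sl\<^sub>2\<close>.\<close> Each factor \<open>k[x]/(x^d)\<close> is an irreducible representation of \<open>sl\<^sub>2\<close> on
  which a multiple of \<open>x\<close> is the raising operator and \<open>x^k \<mapsto> k (d - k) x^(k-1)\<close> a multiple of the
  lowering one. On the tensor product, \<open>\<ell>\<close> and the sum \<open>\<Lambda>\<close> of the lowering operators satisfy
  \<open>\<Lambda> \<ell> - \<ell> \<Lambda> = e\<^sub>S - 2 s\<close> in \<open>S\<close>-degree \<open>s\<close>. In characteristic zero this forces \<open>\<ell>\<close> to be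
  injective on \<open>S\<close>-degrees \<open>s\<close> with \<open>2 s < e\<^sub>S\<close> and surjective onto \<open>S\<close>-degrees \<open>t\<close> with \<open>2 t > e\<^sub>S\<close>
  (\<open>sl2_injective\<close>, \<open>sl2_surjective\<close>). If \<open>e\<^sub>T = 0\<close>, or if \<open>e\<^sub>T = 1\<close> and \<open>e\<close> is even, these two ranges
  cover every degree (\<open>maximal_rank_nearly_full_support\<close>).

  \<^bold>\<open>Maximal rank from a dominant variable.\<close> If \<open>a r \<noteq> 0\<close>, comparison of the powers of \<open>x\<^sub>r\<close> shows that
  \<open>\<ell>\<close> is injective below degree \<open>d r - 1\<close>, and solving \<open>\<ell> = 0\<close> for \<open>x\<^sub>r\<close> shows that \<open>\<ell>\<close> is surjective
  onto degrees above \<open>e - (d r - 1)\<close>. These ranges cover everything as soon as \<open>e \<le> 2 (d r - 1)\<close>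
  (\<open>maximal_rank_dominant\<close>).

  \<^bold>\<open>Failure of maximal rank.\<close> A nonzero element of \<open>A\<close> of degree \<open>k\<close> that is annihilated by \<open>\<ell>\<close> makes
  multiplication by \<open>\<ell>\<close> fail to be injective in degree \<open>k\<close> and, as \<open>A\<close> has a perfect socle pairing,
  fail to be surjective onto degree \<open>e - k\<close>. So \<open>\<ell>\<close> is not a Lefschetz element once there are
  annihilated elements in two (possibly equal) degrees with sum \<open>e - 1\<close>. By Macaulay's inverse system they
  correspond to polynomials \<open>G\<close> with exponents less than \<open>d i\<close> that are killed by the derivation
  \<open>\<Sum> a i \<partial>\<^sub>i\<close>, an element of degree \<open>k\<close> to a polynomial of degree \<open>e - k\<close>. The derivation kills
  all products of brackets \<open>a j x\<^sub>i - a i x\<^sub>j\<close> with \<open>i, j \<in> S\<close> and of variables outside \<open>S\<close>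
  (\<open>ex_apolar\<close>). A count of exponents yields two suitable degrees whenever \<open>e\<^sub>T > 0\<close>, \<open>2 (d i - 1) < e\<close> for all
  \<open>i \<in> S\<close>, and \<open>e\<^sub>T \<ge> 2\<close> or \<open>e\<close> is odd (\<open>not_maximal_rank\<close>).

  The three cases of the classification follow from these results by comparing \<open>e\<close>, \<open>e\<^sub>S\<close> and the
  largest \<open>d i\<close>.
\<close>

section \<open>Coefficients of polynomials\<close>

abbreviation cf :: "('a \<Rightarrow>\<^sub>0 'b::zero) \<Rightarrow> 'a \<Rightarrow> 'b" where
  "cf \<equiv> Poly_Mapping.lookup"

abbreviation mon :: "'a \<Rightarrow> ('a \<Rightarrow>\<^sub>0 'b::zero_neq_one)" where
  "mon m \<equiv> Poly_Mapping.single m 1"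

abbreviation unit_exp :: "nat \<Rightarrow> (nat \<Rightarrow>\<^sub>0 nat)" where
  "unit_exp i \<equiv> Poly_Mapping.single i (Suc 0)"

lemma ex_max_on:
  fixes c :: "'a \<Rightarrow> nat"
  assumes "finite X" "X \<noteq> {}"
  shows "\<exists>x\<in>X. \<forall>y\<in>X. c y \<le> c x"
proof -
  have "Max (c ` X) \<in> c ` X" using assms by (intro Max_in) auto
  then obtain x where "x \<in> X" "c x = Max (c ` X)" by force
  then show ?thesis using assms(1) by (auto intro!: bexI[of _ x])
qed

definition restrict_to :: "'a set \<Rightarrow> ('a \<Rightarrow>\<^sub>0 'b::zero) \<Rightarrow> ('a \<Rightarrow>\<^sub>0 'b)" where
  "restrict_to X p = Poly_Mapping.mapp (\<lambda>m c. if m \<in> X then c else 0) p"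

lemma cf_restrict_to: "cf (restrict_to X p) m = (if m \<in> X then cf p m else 0)"
  by (auto simp: restrict_to_def lookup_mapp in_keys_iff when_def)

lemma sum_monomials: "(\<Sum>m\<in>Poly_Mapping.keys p. Poly_Mapping.single m (cf p m)) = p"
  by (rule poly_mapping_eqI) (auto simp: lookup_sum lookup_single when_def in_keys_iff sum.delta)

lemma cf_single_times:
  fixes p :: "(nat \<Rightarrow>\<^sub>0 nat) \<Rightarrow>\<^sub>0 'k::comm_ring_1"
  shows "cf (Poly_Mapping.single k c * p) (k + l) = c * cf p l"
  by (simp add: lookup_mult lookup_single when_mult)

lemma cf_Const_times: "cf (Const c * p) m = c * cf p m"
  using cf_single_times[of 0 c p m] by (simp add: Const_def)

lemma unit_exp_add_diff_iff: "0 < cf m i \<longleftrightarrow> unit_exp i + (m - unit_exp i) = m"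
proof
  assume "0 < cf m i"
  then show "unit_exp i + (m - unit_exp i) = m"
    by (intro poly_mapping_eqI) (auto simp: lookup_add lookup_minus lookup_single when_def)
next
  assume "unit_exp i + (m - unit_exp i) = m"
  then have "cf (unit_exp i + (m - unit_exp i)) i = cf m i" by simp
  then show "0 < cf m i" by (simp add: lookup_add lookup_minus)
qed

text \<open>
  Truncated subtraction of exponents makes the case distinction necessary: \<open>m - unit_exp i\<close> is a
  true quotient monomial exactly if \<open>x\<^sub>i\<close> divides \<open>m\<close>.
\<close>

lemma cf_Var_times:
  "cf (Var i * p) m = (if 0 < cf m i then cf p (m - unit_exp i) else 0)"
proof (cases "0 < cf m i")
  case True
  then have "m = unit_exp i + (m - unit_exp i)" by (simp only: unit_exp_add_diff_iff)
  then show ?thesis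
    using True cf_single_times[of "unit_exp i" 1 p "m - unit_exp i"] by (simp add: Var_def)
next
  case False
  have "m \<noteq> unit_exp i + q" for q
    using False by (metis add_gr_0 lookup_add lookup_single_eq zero_less_Suc)
  then show ?thesis
    using False by (simp add: Var_def lookup_mult lookup_single when_mult)
qed

lemma cf_Var_times_add: "cf (Var i * p) (m + unit_exp i) = cf p m"
  using cf_single_times[of "unit_exp i" 1 p m] by (simp add: Var_def add.commute)

lemma mon_add_unit_exp: "mon (m + unit_exp i) = Var i * mon m"
  by (simp add: Var_def mult_single add.commute)

lemma mdegree_eq_sum:
  assumes "finite X" "Poly_Mapping.keys m \<subseteq> X"
  shows "mdegree m = (\<Sum>i\<in>X. cf m i)"
  unfolding mdegree_def
  by (rule sum.mono_neutral_left) (use assms in \<open>auto simp: in_keys_iff\<close>)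

lemma mdegree_add: "mdegree (m + m') = mdegree m + mdegree m'"
proof -
  let ?X = "Poly_Mapping.keys m \<union> Poly_Mapping.keys m'"
  have "finite ?X" by simp
  moreover have "Poly_Mapping.keys (m + m') \<subseteq> ?X" by (rule Poly_Mapping.keys_add)
  ultimately show ?thesis
    using mdegree_eq_sum[of ?X "m + m'"] mdegree_eq_sum[of ?X m] mdegree_eq_sum[of ?X m']
    by (simp add: lookup_add sum.distrib)
qed

lemma mdegree_unit_exp [simp]: "mdegree (unit_exp i) = 1"
  by (simp add: mdegree_def)

section \<open>Weighted lowering operators\<close>

text \<open>
  The linear map with \<open>x\<^sub>i^k \<mapsto> w k x\<^sub>i^(k-1)\<close> that treats the other variables as constants, for \<open>w 0 = 0\<close>.
  The weights \<open>w k = k\<close> give the partial derivative, and \<open>w k = k (d - k)\<close> the lowering operator of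
  \<open>sl\<^sub>2\<close>; both are used below, and the commutator with multiplication by a variable is computed for
  both at once.
\<close>

definition lower_var :: "nat \<Rightarrow> (nat \<Rightarrow> 'k) \<Rightarrow> 'k::comm_ring_1 mpoly \<Rightarrow> 'k mpoly" where
  "lower_var i w p = Poly_Mapping.mapp (\<lambda>m c. w (Suc (cf m i)) * c)
     (Poly_Mapping.map_key (\<lambda>m. m + unit_exp i) p)"

lemma cf_lower_var: "cf (lower_var i w p) m = w (Suc (cf m i)) * cf p (m + unit_exp i)"
proof -
  have "inj (\<lambda>m. m + unit_exp i)" by (simp add: inj_def)
  then show ?thesis
    by (auto simp: lower_var_def lookup_mapp map_key.rep_eq in_keys_iff when_def)
qed

text \<open>
  On a monomial with \<open>x\<^sub>i\<close>-exponent \<open>k\<close>, lowering after raising gives the factor \<open>w (k + 1)\<close> and raising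
  after lowering the factor \<open>w k\<close>, which is also correct for \<open>k = 0\<close> because \<open>w 0 = 0\<close>.
\<close>

lemma cf_lower_var_Var_times:
  assumes "w 0 = 0"
  shows "cf (lower_var l w (Var i * p)) m =
    cf (Var i * lower_var l w p) m + (if l = i then (w (Suc (cf m i)) - w (cf m i)) * cf p m else 0)"
proof (cases "l = i")
  case True
  have "m - unit_exp i + unit_exp i = m" if "0 < cf m i"
    using that by (simp only: unit_exp_add_diff_iff add.commute)
  moreover have "Suc (cf (m - unit_exp i) i) = cf m i" if "0 < cf m i"
    using that by (simp add: lookup_minus)
  ultimately show ?thesis using True assms
    by (auto simp: cf_lower_var cf_Var_times_add cf_Var_times lookup_add left_diff_distrib)
next
  case False
  have "m + unit_exp l - unit_exp i = m - unit_exp i + unit_exp l"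
    using False
    by (intro poly_mapping_eqI) (auto simp: lookup_add lookup_minus lookup_single when_def)
  then show ?thesis using False
    by (auto simp: cf_lower_var cf_Var_times lookup_add lookup_minus lookup_single_not_eq)
qed

definition lower :: "nat \<Rightarrow> (nat \<Rightarrow> nat \<Rightarrow> 'k) \<Rightarrow> 'k::comm_ring_1 mpoly \<Rightarrow> 'k mpoly" where
  "lower n w p = (\<Sum>i=1..n. lower_var i (w i) p)"

lemma cf_lower: "cf (lower n w p) m = (\<Sum>i=1..n. w i (Suc (cf m i)) * cf p (m + unit_exp i))"
  by (simp add: lower_def lookup_sum cf_lower_var)

lemma lower_add: "lower n w (p + q) = lower n w p + lower n w q"
  by (rule poly_mapping_eqI) (simp add: cf_lower lookup_add sum.distrib algebra_simps)

lemma lower_Const_times: "lower n w (Const c * p) = Const c * lower n w p"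
  by (rule poly_mapping_eqI) (simp add: cf_lower cf_Const_times sum_distrib_left mult.left_commute)

lemma lower_zero [simp]: "lower n w 0 = 0"
  by (rule poly_mapping_eqI) (simp add: cf_lower)

lemma lower_sum: "lower n w (sum f X) = (\<Sum>x\<in>X. lower n w (f x))"
  by (induction X rule: infinite_finite_induct) (auto simp: lower_add)

lemma cf_lower_Var_times:
  assumes "w i 0 = 0" "\<And>l. w l 0 = 0" "i \<in> {1..n}"
  shows "cf (lower n w (Var i * p)) m =
    cf (Var i * lower n w p) m + (w i (Suc (cf m i)) - w i (cf m i)) * cf p m"
  using assms
  by (simp add: lower_def lookup_sum cf_lower_var_Var_times sum.distrib sum_distrib_left)

lemma cf_linear_form_times:
  "cf (linear_form n a * p) m = (\<Sum>i=1..n. a i * cf (Var i * p) m)"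
  by (simp add: linear_form_def sum_distrib_right lookup_sum cf_Const_times mult.assoc)

lemma cf_lower_linear_form_times:
  assumes "\<And>l. w l 0 = 0"
  shows "cf (lower n w (linear_form n a * p)) m = cf (linear_form n a * lower n w p) m +
    (\<Sum>i=1..n. a i * (w i (Suc (cf m i)) - w i (cf m i))) * cf p m"
proof -
  have "lower n w (linear_form n a * p) = (\<Sum>i=1..n. Const (a i) * lower n w (Var i * p))"
    by (simp add: linear_form_def sum_distrib_right lower_sum mult.assoc lower_Const_times)
  then have "cf (lower n w (linear_form n a * p)) m =
      (\<Sum>i=1..n. a i * cf (lower n w (Var i * p)) m)"
    by (simp add: lookup_sum cf_Const_times)
  also have "\<dots> = (\<Sum>i=1..n. a i * cf (Var i * lower n w p) m +
      a i * (w i (Suc (cf m i)) - w i (cf m i)) * cf p m)"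
    by (rule sum.cong) (simp_all add: cf_lower_Var_times assms distrib_left mult.assoc)
  finally show ?thesis
    by (simp add: cf_linear_form_times sum.distrib sum_distrib_right)
qed

section \<open>The quotient by a monomial complete intersection\<close>

text \<open>
  A polynomial lies in the ideal generated by the \<open>x\<^sub>i ^ d i\<close> if and only if no monomial of \<open>box\<close> occurs
  in it. This criterion is extended to polynomials in all variables: \<open>vanishing\<close> is the ideal
  generated by the \<open>x\<^sub>i ^ d i\<close> and by the variables with index outside \<open>{1..n}\<close>. It has the same
  quotient ring, and no membership in \<open>poly_ring n\<close> has to be tracked.
\<close>

locale lefschetz_setting =
  fixes n :: nat and d :: "nat \<Rightarrow> nat" and a :: "nat \<Rightarrow> 'k::field_char_0"
  assumes d_ge_2: "i \<in> {1..n} \<Longrightarrow> 2 \<le> d i"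
begin

abbreviation ell :: "'k mpoly" where "ell \<equiv> linear_form n a"

definition box :: "(nat \<Rightarrow>\<^sub>0 nat) set" where
  "box = {m. Poly_Mapping.keys m \<subseteq> {1..n} \<and> (\<forall>i\<in>{1..n}. cf m i < d i)}"

definition vanishing :: "'k mpoly set" where
  "vanishing = {p. \<forall>m\<in>box. cf p m = 0}"

text \<open>
  The preimage of the ideal \<open>\<ell> A\<close> of \<open>A\<close>. Surjectivity onto degree \<open>j + 1\<close> means that this ideal
  contains all monomials of degree \<open>j + 1\<close>; the homogeneity of a preimage can be restored afterwards.
\<close>

definition image_ideal :: "'k mpoly set" where
  "image_ideal = {g. \<exists>f. g - ell * f \<in> vanishing}"

lemma box_add_left: assumes "m + m' \<in> box" shows "m' \<in> box"
proof -
  have "cf (m + m') i = cf m i + cf m' i" for i by (simp add: lookup_add)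
  then have le: "cf m' i \<le> cf (m + m') i" for i by simp
  have "Poly_Mapping.keys m' \<subseteq> Poly_Mapping.keys (m + m')"
    using le by (auto simp: in_keys_iff lookup_add)
  then show ?thesis using assms le unfolding box_def by (blast intro: le_less_trans)
qed

lemma vanishing_zero [simp]: "0 \<in> vanishing" by (simp add: vanishing_def)

lemma vanishing_add: "p \<in> vanishing \<Longrightarrow> q \<in> vanishing \<Longrightarrow> p + q \<in> vanishing"
  by (simp add: vanishing_def lookup_add)

lemma vanishing_diff: "p \<in> vanishing \<Longrightarrow> q \<in> vanishing \<Longrightarrow> p - q \<in> vanishing"
  by (simp add: vanishing_def lookup_minus)

lemma vanishing_times: assumes "p \<in> vanishing" shows "q * p \<in> vanishing"
proof -
  have "(cf p l when m = k + l) = 0" if "m \<in> box" for m k l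
    using that assms box_add_left[of k l] by (auto simp: when_def vanishing_def)
  then show ?thesis by (simp add: vanishing_def lookup_mult)
qed

lemma vanishing_subset_image_ideal: "p \<in> vanishing \<Longrightarrow> p \<in> image_ideal"
  unfolding image_ideal_def by (rule CollectI, rule exI[of _ 0]) simp

lemma ell_times_in_image_ideal: "ell * p \<in> image_ideal"
  unfolding image_ideal_def by (rule CollectI, rule exI[of _ p]) simp

lemma image_ideal_add:
  assumes "p \<in> image_ideal" "q \<in> image_ideal" shows "p + q \<in> image_ideal"
proof -
  obtain f g where "p - ell * f \<in> vanishing" "q - ell * g \<in> vanishing"
    using assms unfolding image_ideal_def by auto
  then have "p - ell * f + (q - ell * g) \<in> vanishing" by (rule vanishing_add)
  then have "p + q - ell * (f + g) \<in> vanishing" by (simp add: algebra_simps)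
  then show ?thesis unfolding image_ideal_def by blast
qed

lemma image_ideal_times:
  assumes "p \<in> image_ideal" shows "q * p \<in> image_ideal"
proof -
  obtain f where "p - ell * f \<in> vanishing" using assms unfolding image_ideal_def by auto
  then have "q * (p - ell * f) \<in> vanishing" by (rule vanishing_times)
  then have "q * p - ell * (q * f) \<in> vanishing" by (simp add: algebra_simps)
  then show ?thesis unfolding image_ideal_def by blast
qed

lemma image_ideal_uminus: "p \<in> image_ideal \<Longrightarrow> - p \<in> image_ideal"
  using image_ideal_times[of p "-1"] by simp

lemma image_ideal_diff: "p \<in> image_ideal \<Longrightarrow> q \<in> image_ideal \<Longrightarrow> p - q \<in> image_ideal"
  using image_ideal_add[of p "- q"] image_ideal_uminus[of q] by simp

lemma image_ideal_sum: "(\<And>x. x \<in> X \<Longrightarrow> f x \<in> image_ideal) \<Longrightarrow> sum f X \<in> image_ideal"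
  by (induction X rule: infinite_finite_induct)
     (auto simp: image_ideal_add vanishing_subset_image_ideal)

lemma Const_times_cancel:
  assumes "c \<noteq> 0" shows "Const (inverse c) * (Const c * p) = (p :: 'k mpoly)"
  by (rule poly_mapping_eqI) (simp add: cf_Const_times assms)

lemma image_ideal_Const_cancel:
  assumes "Const c * p \<in> image_ideal" "c \<noteq> 0" shows "p \<in> image_ideal"
  using image_ideal_times[OF assms(1), of "Const (inverse c)"] assms(2)
  by (simp add: Const_times_cancel)

lemma vanishing_Const_cancel:
  assumes "Const c * p \<in> vanishing" "c \<noteq> 0" shows "p \<in> vanishing"
  using vanishing_times[OF assms(1), of "Const (inverse c)"] assms(2)
  by (simp add: Const_times_cancel)

section \<open>The action of sl2\<close>

definition supp :: "nat set" where "supp = {i \<in> {1..n}. a i \<noteq> 0}"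

definition sdeg :: "(nat \<Rightarrow>\<^sub>0 nat) \<Rightarrow> nat" where "sdeg m = (\<Sum>i\<in>supp. cf m i)"

definition esupp :: nat where "esupp = (\<Sum>i\<in>supp. d i - 1)"

text \<open>
  Dividing by \<open>a i\<close> compensates for the coefficient of \<open>x\<^sub>i\<close> in \<open>\<ell>\<close>. For \<open>a i = 0\<close> the weight is zero
  since \<open>inverse 0 = 0\<close>, so that the variables outside \<open>supp\<close> are constants for \<open>sl2_lower\<close>.
\<close>

definition sl2_weight :: "nat \<Rightarrow> nat \<Rightarrow> 'k" where
  "sl2_weight i k = inverse (a i) * of_int (int k * (int (d i) - int k))"

abbreviation sl2_lower :: "'k mpoly \<Rightarrow> 'k mpoly" where
  "sl2_lower \<equiv> lower n sl2_weight"

text \<open>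
  The degree is an integer so that lowering always decreases it by one; once it is negative, the
  polynomial is zero.
\<close>

definition sdeg_homogeneous :: "int \<Rightarrow> 'k mpoly \<Rightarrow> bool" where
  "sdeg_homogeneous s p \<longleftrightarrow> (\<forall>m\<in>Poly_Mapping.keys p. int (sdeg m) = s)"

lemma finite_supp [simp]: "finite supp" by (simp add: supp_def)

lemma int_esupp: "int esupp = (\<Sum>i\<in>supp. int (d i) - 1)"
proof -
  have "int (d i - 1) = int (d i) - 1" if "i \<in> supp" for i
    using d_ge_2[of i] that by (simp add: supp_def of_nat_diff)
  then show ?thesis by (simp add: esupp_def)
qed

lemma sdeg_add: "sdeg (m + m') = sdeg m + sdeg m'"
  by (simp add: sdeg_def lookup_add sum.distrib)

lemma sdeg_unit_exp: "sdeg (unit_exp i) = (if i \<in> supp then 1 else 0)"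
  by (simp add: sdeg_def lookup_single when_def sum.delta)

lemma sdeg_le_esupp: "m \<in> box \<Longrightarrow> sdeg m \<le> esupp"
  unfolding sdeg_def esupp_def
proof (rule sum_mono)
  fix i assume "m \<in> box" "i \<in> supp"
  then have "cf m i < d i" by (simp add: box_def supp_def)
  then show "cf m i \<le> d i - 1" by simp
qed

text \<open>
  For a single variable, \<open>(k + 1) (d - k - 1) - k (d - k) = (d - 1) - 2 k\<close>.
\<close>

lemma sl2_weight_commutator:
  "(\<Sum>i=1..n. a i * (sl2_weight i (Suc (cf m i)) - sl2_weight i (cf m i)))
     = of_int (int esupp - 2 * int (sdeg m))"
proof -
  have "a i * (sl2_weight i (Suc k) - sl2_weight i k)
      = (if a i \<noteq> 0 then of_int (int (d i) - 1 - 2 * int k) else 0)" for i k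
  proof (cases "a i = 0")
    case False
    have "a i * (sl2_weight i (Suc k) - sl2_weight i k) =
        of_int (int (Suc k) * (int (d i) - int (Suc k)) - int k * (int (d i) - int k))"
      using False unfolding sl2_weight_def by (simp only: of_int_diff) (simp add: field_simps)
    also have "int (Suc k) * (int (d i) - int (Suc k)) - int k * (int (d i) - int k)
        = int (d i) - 1 - 2 * int k" by (simp add: algebra_simps)
    finally show ?thesis using False by simp
  qed simp
  then have "(\<Sum>i=1..n. a i * (sl2_weight i (Suc (cf m i)) - sl2_weight i (cf m i)))
      = (\<Sum>i=1..n. if a i \<noteq> 0 then of_int (int (d i) - 1 - 2 * int (cf m i)) else 0)" by simp
  also have "\<dots> = (\<Sum>i\<in>supp. of_int (int (d i) - 1 - 2 * int (cf m i)))"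
    unfolding supp_def by (subst sum.inter_filter) auto
  also have "\<dots> = of_int (\<Sum>i\<in>supp. (int (d i) - 1) - 2 * int (cf m i))" by simp
  also have "(\<Sum>i\<in>supp. (int (d i) - 1) - 2 * int (cf m i)) = int esupp - 2 * int (sdeg m)"
    by (simp only: sum_subtractf int_esupp sdeg_def of_nat_sum sum_distrib_left)
  finally show ?thesis .
qed

lemma sl2_commutator:
  assumes "sdeg_homogeneous s p"
  shows "sl2_lower (ell * p) = ell * sl2_lower p + Const (of_int (int esupp - 2 * s)) * p"
proof (rule poly_mapping_eqI)
  fix m
  have "of_int (int esupp - 2 * int (sdeg m)) * cf p m = of_int (int esupp - 2 * s) * cf p m"
    using assms by (cases "cf p m = 0") (auto simp: sdeg_homogeneous_def in_keys_iff)
  then show "cf (sl2_lower (ell * p)) m =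
      cf (ell * sl2_lower p + Const (of_int (int esupp - 2 * s)) * p) m"
    by (subst cf_lower_linear_form_times)
       (simp_all only: sl2_weight_commutator lookup_add cf_Const_times,
        simp_all add: sl2_weight_def)
qed

lemma sdeg_homogeneous_negative:
  assumes "sdeg_homogeneous s p" "s < 0" shows "p = 0"
proof -
  have "m \<notin> Poly_Mapping.keys p" for m
    using assms unfolding sdeg_homogeneous_def by force
  then show ?thesis by (intro poly_mapping_eqI) (simp add: in_keys_iff)
qed

lemma sdeg_homogeneous_sl2_lower:
  assumes "sdeg_homogeneous s p" shows "sdeg_homogeneous (s - 1) (sl2_lower p)"
  unfolding sdeg_homogeneous_def
proof
  fix m assume "m \<in> Poly_Mapping.keys (sl2_lower p)"
  then have "(\<Sum>i=1..n. sl2_weight i (Suc (cf m i)) * cf p (m + unit_exp i)) \<noteq> 0"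
    by (simp add: in_keys_iff cf_lower)
  then obtain i where i: "i \<in> {1..n}" "sl2_weight i (Suc (cf m i)) * cf p (m + unit_exp i) \<noteq> 0"
    by (rule sum.not_neutral_contains_not_neutral)
  then have "i \<in> supp" "m + unit_exp i \<in> Poly_Mapping.keys p"
    by (auto simp: supp_def sl2_weight_def in_keys_iff)
  then have "int (sdeg (m + unit_exp i)) = s" "sdeg (m + unit_exp i) = Suc (sdeg m)"
    using assms unfolding sdeg_homogeneous_def by (blast, simp add: sdeg_add sdeg_unit_exp)
  then show "int (sdeg m) = s - 1" by simp
qed

lemma sdeg_homogeneous_sl2_lower_power:
  "sdeg_homogeneous s p \<Longrightarrow> sdeg_homogeneous (s - int k) ((sl2_lower ^^ k) p)"
proof (induction k)
  case (Suc k)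
  then show ?case using sdeg_homogeneous_sl2_lower[of "s - int k" "(sl2_lower ^^ k) p"]
    by (simp add: algebra_simps)
qed simp

lemma sdeg_homogeneous_ell_times:
  assumes "sdeg_homogeneous s p" shows "sdeg_homogeneous (s + 1) (ell * p)"
  unfolding sdeg_homogeneous_def
proof
  fix m assume "m \<in> Poly_Mapping.keys (ell * p)"
  then have "(\<Sum>i=1..n. a i * cf (Var i * p) m) \<noteq> 0"
    by (simp add: in_keys_iff cf_linear_form_times)
  then obtain i where i: "i \<in> {1..n}" "a i * cf (Var i * p) m \<noteq> 0"
    by (rule sum.not_neutral_contains_not_neutral)
  then have pos: "0 < cf m i" and key: "cf p (m - unit_exp i) \<noteq> 0" and "i \<in> supp"
    by (auto simp: cf_Var_times supp_def split: if_splits)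
  have "m = unit_exp i + (m - unit_exp i)" using pos by (simp only: unit_exp_add_diff_iff)
  then have "sdeg m = sdeg (unit_exp i) + sdeg (m - unit_exp i)" by (metis sdeg_add)
  moreover have "int (sdeg (m - unit_exp i)) = s"
    using key assms by (simp add: sdeg_homogeneous_def in_keys_iff)
  ultimately show "int (sdeg m) = s + 1" using \<open>i \<in> supp\<close> by (simp add: sdeg_unit_exp)
qed

lemma sdeg_homogeneous_ell_power_times:
  "sdeg_homogeneous s p \<Longrightarrow> sdeg_homogeneous (s + int k) (ell ^ k * p)"
proof (induction k)
  case (Suc k)
  then show ?case using sdeg_homogeneous_ell_times[of "s + int k" "ell ^ k * p"]
    by (simp add: algebra_simps)
qed simp

text \<open>
  The lowering operator acts on the quotient because its weight is zero at the exponent \<open>d i\<close>: from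
  \<open>x\<^sub>i ^ d i\<close> it does not lead back into the box.
\<close>

lemma vanishing_sl2_lower:
  assumes "p \<in> vanishing" shows "sl2_lower p \<in> vanishing"
  unfolding vanishing_def
proof safe
  fix m assume m: "m \<in> box"
  have "sl2_weight i (Suc (cf m i)) * cf p (m + unit_exp i) = 0" if i: "i \<in> {1..n}" for i
  proof (cases "Suc (cf m i) = d i")
    case True
    then show ?thesis by (simp add: sl2_weight_def flip: True)
  next
    case False
    then have "Suc (cf m i) < d i" using m i by (auto simp: box_def Suc_lessI)
    then have "m + unit_exp i \<in> box"
      using m i Poly_Mapping.keys_add[of m "unit_exp i"]
      by (auto simp: box_def lookup_add lookup_single when_def)
    then show ?thesis using assms by (simp add: vanishing_def)
  qed
  then show "cf (sl2_lower p) m = 0" unfolding cf_lower by (rule sum.neutral[OF ballI])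
qed

lemma vanishing_sl2_lower_power:
  "p \<in> vanishing \<Longrightarrow> (sl2_lower ^^ k) p \<in> vanishing"
  by (induction k) (auto simp: vanishing_sl2_lower)

text \<open>
  Moving \<open>\<ell>\<close> past \<open>k + 1\<close> lowering operators collects the commutators of the \<open>S\<close>-degrees
  \<open>s, s - 1, \<dots>, s - k\<close>. They form an arithmetic progression with sum
  \<open>(k + 1) (e\<^sub>S - 2 s + k)\<close>.
\<close>

lemma sl2_commutator_power:
  assumes "sdeg_homogeneous s p"
  shows "(sl2_lower ^^ Suc k) (ell * p) = ell * (sl2_lower ^^ Suc k) p +
    Const (of_int (int (Suc k) * (int esupp - 2 * s + int k))) * (sl2_lower ^^ k) p"
proof (induction k)
  case 0
  then show ?case using sl2_commutator[OF assms] by simp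
next
  case (Suc k)
  let ?q = "(sl2_lower ^^ Suc k) p" and ?c = "int (Suc k) * (int esupp - 2 * s + int k)"
  have "(sl2_lower ^^ Suc (Suc k)) (ell * p) = sl2_lower (ell * ?q) + Const (of_int ?c) * ?q"
    unfolding funpow.simps(2)[of "Suc k"] o_apply Suc.IH lower_add lower_Const_times by simp
  also have "sl2_lower (ell * ?q) = ell * sl2_lower ?q
      + Const (of_int (int esupp - 2 * (s - int (Suc k)))) * ?q"
    by (rule sl2_commutator[OF sdeg_homogeneous_sl2_lower_power[OF assms]])
  also have "\<dots> + Const (of_int ?c) * ?q = ell * sl2_lower ?q
      + Const (of_int (int esupp - 2 * (s - int (Suc k)) + ?c)) * ?q"
    by (simp only: Const_def single_add of_int_add distrib_right add.assoc)
  also have "int esupp - 2 * (s - int (Suc k)) + ?c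
      = int (Suc (Suc k)) * (int esupp - 2 * s + int (Suc k))"
    by (simp add: algebra_simps)
  finally show ?case by simp
qed

text \<open>
  If \<open>\<ell> p = 0\<close> in \<open>A\<close>, the commutator formula turns \<open>\<Lambda>^(k+1) p = 0\<close> into \<open>c \<Lambda>^k p = 0\<close> with a positive
  integer \<open>c\<close>. As \<open>\<Lambda>\<close> is nilpotent on \<open>p\<close>, descending induction on \<open>k\<close> ends with \<open>p = 0\<close>.
\<close>

lemma sl2_injective:
  assumes hom: "sdeg_homogeneous s p" and low: "2 * s < int esupp"
    and van: "ell * p \<in> vanishing"
  shows "p \<in> vanishing"
proof -
  have step: "(sl2_lower ^^ k) p \<in> vanishing" if "(sl2_lower ^^ Suc k) p \<in> vanishing" for k
  proof -
    let ?c = "int (Suc k) * (int esupp - 2 * s + int k)"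
    have "(sl2_lower ^^ Suc k) (ell * p) - ell * (sl2_lower ^^ Suc k) p \<in> vanishing"
      by (intro vanishing_diff vanishing_times that vanishing_sl2_lower_power van)
    then have "Const (of_int ?c) * (sl2_lower ^^ k) p \<in> vanishing"
      unfolding sl2_commutator_power[OF hom] by simp
    moreover have "?c \<noteq> 0" using low by simp
    then have "of_int ?c \<noteq> (0 :: 'k)" by (simp only: of_int_eq_0_iff not_False_eq_True)
    ultimately show ?thesis by (rule vanishing_Const_cancel)
  qed
  define N where "N = nat (s + 1)"
  have "sdeg_homogeneous (s - int N) ((sl2_lower ^^ N) p)"
    by (rule sdeg_homogeneous_sl2_lower_power[OF hom])
  then have "(sl2_lower ^^ N) p = 0"
    by (rule sdeg_homogeneous_negative) (simp add: N_def)
  then have "(sl2_lower ^^ N) p \<in> vanishing" by simp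
  then have "(sl2_lower ^^ 0) p \<in> vanishing"
  proof (induction N)
    case (Suc N)
    then show ?case using step by blast
  qed
  then show ?thesis by simp
qed

text \<open>
  Dual to the injectivity: modulo the image of \<open>\<ell>\<close>, the element \<open>\<Lambda>^(k+1) \<ell>^(k+1) p\<close> is a multiple of
  \<open>\<Lambda>^k \<ell>^k p\<close> by a negative integer, and \<open>\<ell>^N p = 0\<close> in \<open>A\<close> for large \<open>N\<close>.
\<close>

lemma sl2_surjective:
  assumes hom: "sdeg_homogeneous t p" and high: "int esupp < 2 * t"
  shows "p \<in> image_ideal"
proof -
  have step: "(sl2_lower ^^ k) (ell ^ k * p) \<in> image_ideal"
    if "(sl2_lower ^^ Suc k) (ell ^ Suc k * p) \<in> image_ideal" for k
  proof -
    let ?c = "int (Suc k) * (int esupp - 2 * (t + int k) + int k)"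
    have "(sl2_lower ^^ Suc k) (ell * (ell ^ k * p)) - ell * (sl2_lower ^^ Suc k) (ell ^ k * p)
        \<in> image_ideal"
      using that by (intro image_ideal_diff ell_times_in_image_ideal) (simp add: mult.assoc)
    then have "Const (of_int ?c) * (sl2_lower ^^ k) (ell ^ k * p) \<in> image_ideal"
      unfolding sl2_commutator_power[OF sdeg_homogeneous_ell_power_times[OF hom]] by simp
    moreover have "?c \<noteq> 0" using high by simp
    then have "of_int ?c \<noteq> (0 :: 'k)" by (simp only: of_int_eq_0_iff not_False_eq_True)
    ultimately show ?thesis by (rule image_ideal_Const_cancel)
  qed
  \<comment> \<open>The powers of \<open>\<ell>\<close> eventually exceed every \<open>S\<close>-degree that occurs in the box.\<close>
  define N where "N = Suc esupp"
  have "0 \<le> t" using high by linarith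
  have "ell ^ N * p \<in> vanishing"
    unfolding vanishing_def
  proof safe
    fix m assume "m \<in> box"
    then have "int (sdeg m) \<noteq> t + int N" using sdeg_le_esupp[of m] \<open>0 \<le> t\<close> by (simp add: N_def)
    then show "cf (ell ^ N * p) m = 0"
      using sdeg_homogeneous_ell_power_times[OF hom, of N]
      by (auto simp: sdeg_homogeneous_def in_keys_iff)
  qed
  then have "(sl2_lower ^^ N) (ell ^ N * p) \<in> image_ideal"
    by (intro vanishing_subset_image_ideal vanishing_sl2_lower_power)
  then have "(sl2_lower ^^ 0) (ell ^ 0 * p) \<in> image_ideal"
  proof (induction N)
    case (Suc N)
    then show ?case using step by blast
  qed
  then show ?thesis by simp
qed

section \<open>Degrees in which the map has maximal rank\<close>

definition socle_degree :: nat where "socle_degree = (\<Sum>i=1..n. d i - 1)"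

text \<open>
  The polynomials supported on monomials of \<open>box\<close> of degree \<open>j\<close> are the normal forms of the elements
  of \<open>A\<close> of degree \<open>j\<close>.
\<close>

definition box_homogeneous :: "nat \<Rightarrow> 'k mpoly \<Rightarrow> bool" where
  "box_homogeneous j f \<longleftrightarrow> (\<forall>m\<in>Poly_Mapping.keys f. m \<in> box \<and> mdegree m = j)"

definition injective_at :: "nat \<Rightarrow> bool" where
  "injective_at j \<longleftrightarrow> (\<forall>f. box_homogeneous j f \<longrightarrow> ell * f \<in> vanishing \<longrightarrow> f = 0)"

definition surjective_at :: "nat \<Rightarrow> bool" where
  "surjective_at j \<longleftrightarrow> (\<forall>m\<in>box. mdegree m = Suc j \<longrightarrow> mon m \<in> image_ideal)"

lemma cf_box: "m \<in> box \<Longrightarrow> i \<in> {1..n} \<Longrightarrow> cf m i \<le> d i - 1"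
proof -
  assume "m \<in> box" "i \<in> {1..n}"
  then have "cf m i < d i" by (simp add: box_def)
  then show ?thesis by simp
qed

lemma mdegree_box: "m \<in> box \<Longrightarrow> mdegree m = (\<Sum>i=1..n. cf m i)"
  by (rule mdegree_eq_sum) (auto simp: box_def)

lemma mon_vanishing: "m \<notin> box \<Longrightarrow> mon m \<in> vanishing"
  by (auto simp: vanishing_def lookup_single when_def)

lemma sum_supp_split:
  "(\<Sum>i=1..n. f i) = (\<Sum>i\<in>supp. f i) + (\<Sum>i\<in>{1..n} - supp. f i :: nat)"
  by (subst sum.subset_diff[of supp]) (auto simp: supp_def)

text \<open>
  The product of \<open>\<ell>\<close> with a homogeneous component is a homogeneous component of the product; \<open>X\<close>
  selects the former and \<open>P\<close> says whether \<open>m\<close> belongs to the latter.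
\<close>

lemma cf_ell_times_restrict_to:
  assumes "\<And>i. i \<in> supp \<Longrightarrow> 0 < cf m i \<Longrightarrow> m - unit_exp i \<in> X \<longleftrightarrow> P"
  shows "cf (ell * restrict_to X f) m = (if P then cf (ell * f) m else 0)"
proof -
  have "a i * cf (Var i * restrict_to X f) m = (if P then a i * cf (Var i * f) m else 0)"
    if "i \<in> {1..n}" for i
    using that assms[of i] by (auto simp: cf_Var_times cf_restrict_to supp_def)
  then show ?thesis by (auto simp: cf_linear_form_times intro!: sum.cong sum.neutral)
qed

lemma sdeg_minus_unit_exp:
  assumes "i \<in> supp" "0 < cf m i" shows "Suc (sdeg (m - unit_exp i)) = sdeg m"
proof -
  have "m = unit_exp i + (m - unit_exp i)" using assms by (simp only: unit_exp_add_diff_iff)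
  then have "sdeg m = sdeg (unit_exp i) + sdeg (m - unit_exp i)" by (metis sdeg_add)
  then show ?thesis using assms by (simp add: sdeg_unit_exp)
qed

text \<open>
  The components of an element with respect to the \<open>S\<close>-degree are annihilated one by one, and their
  \<open>S\<close>-degrees are at most \<open>j\<close>.
\<close>

lemma injective_at_low_degree:
  assumes "2 * j < esupp" shows "injective_at j"
  unfolding injective_at_def
proof (intro allI impI)
  fix f assume f: "box_homogeneous j f" and van: "ell * f \<in> vanishing"
  have "cf f m = 0" for m
  proof (rule ccontr)
    assume "cf f m \<noteq> 0"
    then have m: "m \<in> box" "mdegree m = j"
      using f by (auto simp: box_homogeneous_def in_keys_iff)
    define g where "g = restrict_to {m'. sdeg m' = sdeg m} f"
    have "ell * g \<in> vanishing"
      unfolding vanishing_def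
    proof safe
      fix \<mu> assume "\<mu> \<in> box"
      have "cf (ell * g) \<mu> = (if sdeg \<mu> = Suc (sdeg m) then cf (ell * f) \<mu> else 0)"
        unfolding g_def
      proof (rule cf_ell_times_restrict_to)
        fix i assume "i \<in> supp" "0 < cf \<mu> i"
        then have "Suc (sdeg (\<mu> - unit_exp i)) = sdeg \<mu>" by (rule sdeg_minus_unit_exp)
        then show "\<mu> - unit_exp i \<in> {m'. sdeg m' = sdeg m} \<longleftrightarrow> sdeg \<mu> = Suc (sdeg m)" by auto
      qed
      then show "cf (ell * g) \<mu> = 0" using van \<open>\<mu> \<in> box\<close> by (simp add: vanishing_def)
    qed
    moreover have "sdeg_homogeneous (int (sdeg m)) g"
      by (auto simp: sdeg_homogeneous_def g_def in_keys_iff cf_restrict_to split: if_splits)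
    moreover have "sdeg m \<le> j"
      using m mdegree_box[of m] sum_supp_split[of "cf m"] by (simp add: sdeg_def)
    then have "2 * int (sdeg m) < int esupp" using assms by linarith
    ultimately have "g \<in> vanishing" by (metis sl2_injective)
    then show False using m \<open>cf f m \<noteq> 0\<close> by (auto simp: vanishing_def g_def cf_restrict_to)
  qed
  then show "f = 0" by (intro poly_mapping_eqI) simp
qed

text \<open>
  The variables outside \<open>supp\<close> contribute at most \<open>socle_degree - esupp\<close> to the degree of a monomial
  of \<open>box\<close>, so its \<open>S\<close>-degree is still in the range of \<open>sl2_surjective\<close>.
\<close>

lemma surjective_at_high_degree:
  assumes "esupp + 2 * (socle_degree - esupp) < 2 * Suc j" shows "surjective_at j"
  unfolding surjective_at_def
proof (intro ballI impI)
  fix m assume m: "m \<in> box" "mdegree m = Suc j"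
  have "(\<Sum>i\<in>{1..n} - supp. cf m i) \<le> (\<Sum>i\<in>{1..n} - supp. d i - 1)"
    using m by (intro sum_mono) (auto dest: cf_box)
  also have "\<dots> = socle_degree - esupp"
    using sum_supp_split[of "\<lambda>i. d i - 1"] by (simp add: socle_degree_def esupp_def)
  finally have "Suc j \<le> sdeg m + (socle_degree - esupp)"
    using m mdegree_box[of m] sum_supp_split[of "cf m"] by (simp add: sdeg_def)
  then have "2 * Suc j \<le> 2 * sdeg m + 2 * (socle_degree - esupp)" by simp
  then have "esupp < 2 * sdeg m" using assms by simp
  then have "int esupp < 2 * int (sdeg m)" by linarith
  moreover have "sdeg_homogeneous (int (sdeg m)) (mon m)"
    by (simp add: sdeg_homogeneous_def)
  ultimately show "mon m \<in> image_ideal" by (rule sl2_surjective[rotated])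
qed

text \<open>
  Let \<open>m\<close> be a monomial of \<open>f\<close> with maximal exponent of \<open>x\<^sub>r\<close>. Then \<open>x\<^sub>r m\<close> arises in \<open>\<ell> f\<close> from \<open>m\<close>
  alone, and it is still in the box because this exponent is at most the degree \<open>j < d r - 1\<close>.
\<close>

lemma injective_at_dominant:
  assumes r: "r \<in> {1..n}" "a r \<noteq> 0" and j: "j < d r - 1"
  shows "injective_at j"
  unfolding injective_at_def
proof (intro allI impI, rule ccontr)
  fix f assume f: "box_homogeneous j f" and van: "ell * f \<in> vanishing" and "f \<noteq> 0"
  then obtain m where m: "m \<in> Poly_Mapping.keys f"
    and max: "\<And>m'. m' \<in> Poly_Mapping.keys f \<Longrightarrow> cf m' r \<le> cf m r"
    using ex_max_on[of "Poly_Mapping.keys f" "\<lambda>m. cf m r"] by auto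
  have box: "m \<in> box" "mdegree m = j" using f m by (auto simp: box_homogeneous_def)
  have "cf m r \<le> j"
    using box mdegree_box[of m] r member_le_sum[of r "{1..n}" "cf m"] by simp
  then have "m + unit_exp r \<in> box"
    using box(1) r j Poly_Mapping.keys_add[of m "unit_exp r"]
    by (auto simp: box_def lookup_add lookup_single when_def)
  then have "cf (ell * f) (m + unit_exp r) = 0" using van by (simp add: vanishing_def)
  moreover have "a i * cf (Var i * f) (m + unit_exp r) = (if i = r then a r * cf f m else 0)"
    if "i \<in> {1..n}" for i
  proof (cases "i = r")
    case True
    then show ?thesis by (simp add: cf_Var_times_add)
  next
    case False
    have "cf (m + unit_exp r - unit_exp i) r = Suc (cf m r)"
      using False by (simp add: lookup_add lookup_minus lookup_single)
    then have "m + unit_exp r - unit_exp i \<notin> Poly_Mapping.keys f"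
      using max[of "m + unit_exp r - unit_exp i"] by auto
    then show ?thesis using False by (simp add: cf_Var_times in_keys_iff)
  qed
  ultimately have "a r * cf f m = 0" using r by (simp add: cf_linear_form_times)
  then show False using r m by (simp add: in_keys_iff)
qed

lemma ell_times_mon: "ell * mon m = (\<Sum>i=1..n. Const (a i) * mon (m + unit_exp i))"
  by (simp only: linear_form_def sum_distrib_right mon_add_unit_exp mult.assoc)

text \<open>
  Modulo \<open>\<ell>\<close>, the variable \<open>x\<^sub>r\<close> is a linear combination of the other variables. Replacing its
  occurrences one by one leads to monomials without \<open>x\<^sub>r\<close>, of degree too large for the box.
\<close>

lemma mon_in_image_ideal_dominant:
  assumes r: "r \<in> {1..n}" "a r \<noteq> 0"
  shows "socle_degree < mdegree m + (d r - 1) \<Longrightarrow> mon m \<in> image_ideal"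
proof (induction "cf m r" arbitrary: m)
  case 0
  have "m \<notin> box"
  proof
    assume m: "m \<in> box"
    have "mdegree m = (\<Sum>i\<in>{1..n} - {r}. cf m i)"
      using mdegree_box[OF m] r 0 by (simp add: sum.remove)
    also have "\<dots> \<le> (\<Sum>i\<in>{1..n} - {r}. d i - 1)"
      by (intro sum_mono) (use m in \<open>auto dest: cf_box\<close>)
    finally have "mdegree m + (d r - 1) \<le> socle_degree"
      using r by (simp add: socle_degree_def sum.remove)
    then show False using 0 by simp
  qed
  then show ?case by (intro vanishing_subset_image_ideal mon_vanishing)
next
  case (Suc k)
  define m' where "m' = m - unit_exp r"
  have "0 < cf m r" using Suc.hyps(2) by simp
  then have "unit_exp r + m' = m" unfolding m'_def by (rule iffD1[OF unit_exp_add_diff_iff])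
  then have m: "m = m' + unit_exp r" by (simp only: add.commute)
  have "mon (m' + unit_exp i) \<in> image_ideal" if i: "i \<in> {1..n} - {r}" for i
  proof (rule Suc.hyps(1))
    show "k = cf (m' + unit_exp i) r"
      using i Suc.hyps(2) by (simp add: m lookup_add lookup_single)
    show "socle_degree < mdegree (m' + unit_exp i) + (d r - 1)"
      using Suc.prems by (simp add: m mdegree_add)
  qed
  then have "(\<Sum>i\<in>{1..n} - {r}. Const (a i) * mon (m' + unit_exp i)) \<in> image_ideal"
    by (intro image_ideal_sum image_ideal_times)
  then have "ell * mon m' - (\<Sum>i\<in>{1..n} - {r}. Const (a i) * mon (m' + unit_exp i))
      \<in> image_ideal"
    by (intro image_ideal_diff ell_times_in_image_ideal)
  moreover have "ell * mon m' = Const (a r) * mon m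
      + (\<Sum>i\<in>{1..n} - {r}. Const (a i) * mon (m' + unit_exp i))"
    unfolding ell_times_mon m using r(1) by (intro sum.remove) simp_all
  ultimately have "Const (a r) * mon m \<in> image_ideal" by simp
  then show ?case using r(2) by (rule image_ideal_Const_cancel)
qed

lemma surjective_at_dominant:
  assumes "r \<in> {1..n}" "a r \<noteq> 0" "socle_degree < Suc j + (d r - 1)"
  shows "surjective_at j"
  unfolding surjective_at_def
  by (intro ballI impI mon_in_image_ideal_dominant[OF assms(1,2)]) (use assms(3) in simp)

section \<open>Annihilated elements and the socle pairing\<close>

definition top_exp :: "nat \<Rightarrow>\<^sub>0 nat" where
  "top_exp = (\<Sum>i=1..n. Poly_Mapping.single i (d i - 1))"

lemma cf_top_exp: "cf top_exp i = (if i \<in> {1..n} then d i - 1 else 0)"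
  by (auto simp: top_exp_def lookup_sum lookup_single when_def sum.delta)

lemma cf_box_le_top: assumes "m \<in> box" shows "cf m i \<le> cf top_exp i"
proof (cases "i \<in> {1..n}")
  case True
  then show ?thesis using cf_box[OF assms True] by (simp add: cf_top_exp)
next
  case False
  then have "i \<notin> Poly_Mapping.keys m" using assms by (auto simp: box_def)
  then show ?thesis by (simp add: in_keys_iff)
qed

lemma add_top_diff: assumes "m \<in> box" shows "m + (top_exp - m) = top_exp"
  by (rule poly_mapping_eqI)
     (simp only: lookup_add lookup_minus le_add_diff_inverse cf_box_le_top[OF assms])

lemma top_in_box: "top_exp \<in> box"
proof -
  have "Poly_Mapping.keys top_exp \<subseteq> {1..n}"
    by (auto simp: in_keys_iff cf_top_exp split: if_splits)
  moreover have "cf top_exp i < d i" if "i \<in> {1..n}" for i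
    using d_ge_2[OF that] that by (simp add: cf_top_exp)
  ultimately show ?thesis by (simp add: box_def)
qed

lemma top_diff_in_box: "m \<in> box \<Longrightarrow> top_exp - m \<in> box"
  using top_in_box add_top_diff[of m] box_add_left[of m "top_exp - m"] by simp

lemma top_diff_top_diff: "m \<in> box \<Longrightarrow> top_exp - (top_exp - m) = m"
  using add_diff_cancel_right'[of m "top_exp - m"] add_top_diff[of m] by simp

lemma mdegree_top_diff: "m \<in> box \<Longrightarrow> mdegree m + mdegree (top_exp - m) = socle_degree"
proof -
  assume "m \<in> box"
  then have "mdegree m + mdegree (top_exp - m) = mdegree top_exp"
    using mdegree_add[of m "top_exp - m"] by (simp add: add_top_diff)
  also have "\<dots> = socle_degree"
    using mdegree_box[OF top_in_box] by (simp add: cf_top_exp socle_degree_def)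
  finally show ?thesis .
qed

definition kernel_degree :: "nat \<Rightarrow> bool" where
  "kernel_degree j \<longleftrightarrow> (\<exists>u. u \<noteq> 0 \<and> box_homogeneous j u \<and> ell * u \<in> vanishing)"

lemma not_injective_at_kernel_degree: "kernel_degree j \<Longrightarrow> \<not> injective_at j"
  by (auto simp: kernel_degree_def injective_at_def)

text \<open>
  If \<open>\<ell> u = 0\<close>, the product with \<open>u\<close> kills the image of \<open>\<ell>\<close>. But if \<open>m\<close> is a
  monomial of \<open>u\<close>, it does not kill the monomial \<open>top_exp - m\<close>, since the coefficient of the socle
  monomial in this product is that of \<open>m\<close> in \<open>u\<close>.
\<close>

lemma not_surjective_at_kernel_degree:
  assumes "kernel_degree k" "k + Suc j = socle_degree"
  shows "\<not> surjective_at j"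
proof
  assume surj: "surjective_at j"
  obtain u where u: "u \<noteq> 0" "box_homogeneous k u" "ell * u \<in> vanishing"
    using assms unfolding kernel_degree_def by blast
  then obtain m where m: "m \<in> Poly_Mapping.keys u" by (meson ex_in_conv keys_eq_empty)
  then have box: "m \<in> box" "mdegree m = k" using u by (auto simp: box_homogeneous_def)
  then have "mdegree (top_exp - m) = Suc j" using mdegree_top_diff[of m] assms by simp
  then obtain f where "mon (top_exp - m) - ell * f \<in> vanishing"
    using surj top_diff_in_box[OF box(1)] unfolding surjective_at_def image_ideal_def by blast
  then have "u * (mon (top_exp - m) - ell * f) + f * (ell * u) \<in> vanishing"
    by (intro vanishing_add vanishing_times u)
  then have "mon (top_exp - m) * u \<in> vanishing" by (simp add: algebra_simps)
  moreover have "top_exp - m + m = top_exp"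
    using add_top_diff[OF box(1)] by (simp add: add.commute)
  ultimately have "cf (mon (top_exp - m) * u) (top_exp - m + m) = 0"
    using top_in_box by (simp add: vanishing_def)
  then have "cf u m = 0" by (simp only: cf_single_times mult_1)
  then show False using m by (simp add: in_keys_iff)
qed

section \<open>Macaulay's inverse system\<close>

abbreviation ell_diff :: "'k mpoly \<Rightarrow> 'k mpoly" where
  "ell_diff \<equiv> lower n (\<lambda>i k. a i * of_nat k)"

definition fact_exp :: "(nat \<Rightarrow>\<^sub>0 nat) \<Rightarrow> 'k" where
  "fact_exp m = (\<Prod>i=1..n. fact (cf m i))"

lemma fact_exp_nonzero: "fact_exp m \<noteq> 0"
  by (simp add: fact_exp_def)

lemma fact_exp_add_unit_exp:
  assumes "i \<in> {1..n}"
  shows "fact_exp (m + unit_exp i) = of_nat (Suc (cf m i)) * fact_exp m"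
proof -
  have "(\<Prod>l\<in>{1..n} - {i}. fact (cf (m + unit_exp i) l) :: 'k) = (\<Prod>l\<in>{1..n} - {i}. fact (cf m l))"
    by (rule prod.cong) (auto simp: lookup_add lookup_single)
  then show ?thesis using assms
    by (simp add: fact_exp_def prod.remove[of _ i] lookup_add)
qed

text \<open>
  The substitution of \<open>m!\<close> times the socle monomial divided by \<open>m\<close> for each monomial \<open>m\<close> turns the
  partial derivative \<open>\<partial>\<^sub>i\<close> into multiplication by \<open>x\<^sub>i\<close>, because \<open>\<partial>\<^sub>i\<close> takes \<open>x\<^sub>i^k / k!\<close> to
  \<open>x\<^sub>i^(k-1) / (k-1)!\<close>. It therefore takes solutions of the differential equation to elements
  annihilated by \<open>\<ell>\<close>.
\<close>

lemma kernel_degree_if_ell_diff_eq_0: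
  assumes "G \<noteq> 0" and G: "box_homogeneous b G" and diff: "ell_diff G = 0"
  shows "kernel_degree (socle_degree - b) \<and> b \<le> socle_degree"
proof -
  define u where "u = (\<Sum>m\<in>Poly_Mapping.keys G.
    Poly_Mapping.single (top_exp - m) (fact_exp m * cf G m))"
  have box: "m \<in> box" "mdegree m = b" if "cf G m \<noteq> 0" for m
    using G that by (auto simp: box_homogeneous_def in_keys_iff)
  have cf_u: "cf u \<nu> = fact_exp (top_exp - \<nu>) * cf G (top_exp - \<nu>)" if \<nu>: "\<nu> \<in> box" for \<nu>
  proof -
    have "cf u \<nu> = (\<Sum>m\<in>Poly_Mapping.keys G. if m = top_exp - \<nu> then fact_exp m * cf G m else 0)"
      unfolding u_def lookup_sum
    proof (rule sum.cong[OF refl])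
      fix m assume "m \<in> Poly_Mapping.keys G"
      then have "m \<in> box" using box by (simp add: in_keys_iff)
      then have "top_exp - m = \<nu> \<longleftrightarrow> m = top_exp - \<nu>"
        using top_diff_top_diff[of m] top_diff_top_diff[OF \<nu>] by metis
      then show "cf (Poly_Mapping.single (top_exp - m) (fact_exp m * cf G m)) \<nu>
          = (if m = top_exp - \<nu> then fact_exp m * cf G m else 0)"
        by (simp add: lookup_single when_def)
    qed
    then show ?thesis by (simp add: sum.delta in_keys_iff)
  qed
  have "m \<in> box \<and> mdegree m = socle_degree - b" if "m \<in> Poly_Mapping.keys u" for m
  proof -
    have "(\<Sum>m'\<in>Poly_Mapping.keys G.
        cf (Poly_Mapping.single (top_exp - m') (fact_exp m' * cf G m')) m) \<noteq> 0"
      using that by (simp add: in_keys_iff u_def lookup_sum)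
    then obtain m' where m': "m' \<in> Poly_Mapping.keys G"
      "cf (Poly_Mapping.single (top_exp - m') (fact_exp m' * cf G m')) m \<noteq> 0"
      by (rule sum.not_neutral_contains_not_neutral)
    then have "cf G m' \<noteq> 0" "m = top_exp - m'"
      by (auto simp: lookup_single when_def split: if_splits)
    then show ?thesis
      using box[of m'] top_diff_in_box[of m'] mdegree_top_diff[of m'] by simp
  qed
  then have hom: "box_homogeneous (socle_degree - b) u" by (simp add: box_homogeneous_def)
  obtain m where m: "cf G m \<noteq> 0"
    using \<open>G \<noteq> 0\<close> keys_eq_empty[of G] by (auto simp: in_keys_iff simp del: keys_eq_empty)
  have "cf u (top_exp - m) \<noteq> 0"
    using m box[OF m] by (simp add: cf_u top_diff_in_box top_diff_top_diff fact_exp_nonzero)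
  then have "u \<noteq> 0" by auto
  moreover have "ell * u \<in> vanishing"
    unfolding vanishing_def
  proof safe
    fix \<mu> assume \<mu>: "\<mu> \<in> box"
    define \<nu> where "\<nu> = top_exp - \<mu>"
    have \<nu>: "\<nu> \<in> box" "\<mu> + \<nu> = top_exp"
      using top_diff_in_box[OF \<mu>] add_top_diff[OF \<mu>] by (auto simp: \<nu>_def)
    have "cf (Var i * u) \<mu> = fact_exp \<nu> * (of_nat (Suc (cf \<nu> i)) * cf G (\<nu> + unit_exp i))"
      if i: "i \<in> {1..n}" for i
    proof (cases "0 < cf \<mu> i")
      case True
      then have eq: "unit_exp i + (\<mu> - unit_exp i) = \<mu>" by (rule iffD1[OF unit_exp_add_diff_iff])
      then have "\<mu> - unit_exp i \<in> box" using \<mu> box_add_left[of "unit_exp i" "\<mu> - unit_exp i"] by (simp only: eq)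
      moreover have "top_exp - (\<mu> - unit_exp i) = \<nu> + unit_exp i"
      proof -
        have "(\<mu> - unit_exp i) + (\<nu> + unit_exp i) = (unit_exp i + (\<mu> - unit_exp i)) + \<nu>"
          by (simp only: ac_simps)
        also have "\<dots> = top_exp" unfolding eq by (rule \<nu>(2))
        finally show ?thesis
          using add_diff_cancel_left'[of "\<mu> - unit_exp i" "\<nu> + unit_exp i"] by simp
      qed
      ultimately show ?thesis
        using True i by (simp add: cf_Var_times cf_u fact_exp_add_unit_exp mult.assoc)
    next
      case False
      then have "cf \<nu> i = d i - 1" using i by (simp add: \<nu>_def lookup_minus cf_top_exp)
      then have "\<not> cf (\<nu> + unit_exp i) i < d i" by (simp add: lookup_add)
      then have "cf G (\<nu> + unit_exp i) = 0" using box i unfolding box_def by blast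
      then show ?thesis using False by (simp add: cf_Var_times)
    qed
    then have "cf (ell * u) \<mu> = (\<Sum>i=1..n. fact_exp \<nu> *
        (a i * of_nat (Suc (cf \<nu> i)) * cf G (\<nu> + unit_exp i)))"
      unfolding cf_linear_form_times by (intro sum.cong refl) (simp only: mult_ac)
    also have "\<dots> = fact_exp \<nu> * cf (ell_diff G) \<nu>"
      unfolding cf_lower by (rule sum_distrib_left[symmetric])
    finally show "cf (ell * u) \<mu> = 0" by (simp add: diff)
  qed
  ultimately have "kernel_degree (socle_degree - b)"
    using hom unfolding kernel_degree_def by blast
  moreover have "b \<le> socle_degree" using mdegree_top_diff[OF box(1)[OF m]] box(2)[OF m] by linarith
  ultimately show ?thesis by blast
qed

text \<open>
  The bounds \<open>c\<close> on the exponents are variable since the polynomials are built factor by factor.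
\<close>

definition apolar :: "(nat \<Rightarrow> nat) \<Rightarrow> nat \<Rightarrow> 'k mpoly \<Rightarrow> bool" where
  "apolar c b G \<longleftrightarrow> G \<noteq> 0 \<and> ell_diff G = 0 \<and>
    (\<forall>m\<in>Poly_Mapping.keys G. Poly_Mapping.keys m \<subseteq> {1..n} \<and> (\<forall>i\<in>{1..n}. cf m i \<le> c i)
      \<and> mdegree m = b)"

lemma apolar_one: "apolar c 0 1"
  unfolding apolar_def
proof (intro conjI)
  show "ell_diff 1 = 0"
  proof (rule poly_mapping_eqI)
    fix m
    have "cf (1 :: 'k mpoly) (m + unit_exp i) = 0" for i
    proof -
      have "cf (m + unit_exp i) i \<noteq> 0" by (simp add: lookup_add)
      then have "m + unit_exp i \<noteq> 0" by auto
      then show ?thesis by (simp add: lookup_one when_def)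
    qed
    then show "cf (ell_diff 1) m = cf 0 m" by (simp add: cf_lower)
  qed
qed (auto simp: mdegree_def)

lemma keys_Var_times:
  assumes "m \<in> Poly_Mapping.keys (Var i * G)"
  obtains m' where "m = m' + unit_exp i" "m' \<in> Poly_Mapping.keys G"
proof -
  have pos: "0 < cf m i" and key: "m - unit_exp i \<in> Poly_Mapping.keys G"
    using assms by (auto simp: in_keys_iff cf_Var_times split: if_splits)
  have "m = m - unit_exp i + unit_exp i"
    using iffD1[OF unit_exp_add_diff_iff pos] by (simp only: add.commute)
  then show ?thesis using key that by blast
qed

lemma ell_diff_Var_times:
  assumes "i \<in> {1..n}"
  shows "ell_diff (Var i * G) = Var i * ell_diff G + Const (a i) * G"
proof (rule poly_mapping_eqI)
  fix m
  have "cf (ell_diff (Var i * G)) m = cf (Var i * ell_diff G) m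
      + (a i * of_nat (Suc (cf m i)) - a i * of_nat (cf m i)) * cf G m"
    by (rule cf_lower_Var_times) (use assms in auto)
  moreover have "a i * of_nat (Suc (cf m i)) - a i * of_nat (cf m i) = a i"
    by (simp add: algebra_simps)
  ultimately show "cf (ell_diff (Var i * G)) m = cf (Var i * ell_diff G + Const (a i) * G) m"
    by (simp only: lookup_add cf_Const_times)
qed

lemma Var_nonzero: "Var i \<noteq> (0 :: 'k mpoly)"
proof -
  have "cf (Var i :: 'k mpoly) (unit_exp i) = 1" by (simp add: Var_def)
  then show ?thesis by auto
qed

lemma apolar_Var_times:
  assumes G: "apolar (c(t := c t - 1)) b G" and t: "t \<in> {1..n} - supp" "0 < c t"
  shows "apolar c (Suc b) (Var t * G)"
  unfolding apolar_def
proof (intro conjI ballI)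
  have "a t = 0" using t by (simp add: supp_def)
  then show "ell_diff (Var t * G) = 0"
    using G t by (simp add: ell_diff_Var_times apolar_def Const_def)
  show "Var t * G \<noteq> 0" using G by (simp add: apolar_def Var_nonzero)
  fix m assume "m \<in> Poly_Mapping.keys (Var t * G)"
  then obtain m' where m: "m = m' + unit_exp t" and m': "m' \<in> Poly_Mapping.keys G"
    by (rule keys_Var_times)
  show "mdegree m = Suc b" using G m m' by (simp add: apolar_def mdegree_add)
  show "Poly_Mapping.keys m \<subseteq> {1..n}"
  proof -
    have "Poly_Mapping.keys m' \<subseteq> {1..n}" using G m' by (simp add: apolar_def)
    moreover have "Poly_Mapping.keys m \<subseteq> Poly_Mapping.keys m' \<union> {t}"
      using Poly_Mapping.keys_add[of m' "unit_exp t"] by (simp add: m)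
    ultimately show ?thesis using t(1) by blast
  qed
  fix i assume "i \<in> {1..n}"
  then have "cf m' i \<le> (c(t := c t - 1)) i" using G m' by (auto simp: apolar_def)
  then show "cf m i \<le> c i" using t by (auto simp: m lookup_add lookup_single split: if_splits)
qed

text \<open>
  The derivation \<open>\<Sum> a i \<partial>\<^sub>i\<close> sends the bracket \<open>a j x\<^sub>i - a i x\<^sub>j\<close> to \<open>a j a i - a i a j = 0\<close>.
\<close>

lemma apolar_bracket_times:
  assumes G: "apolar (c(i := c i - 1, j := c j - 1)) b G"
    and ij: "i \<in> supp" "j \<in> supp" "i \<noteq> j" and c: "0 < c i" "0 < c j"
  shows "apolar c (Suc b) ((Const (a j) * Var i - Const (a i) * Var j) * G)"
  unfolding apolar_def
proof (intro conjI ballI)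
  let ?B = "Const (a j) * Var i - Const (a i) * Var j"
  have "?B * G = Const (a j) * (Var i * G) + Const (- a i) * (Var j * G)"
    by (simp add: algebra_simps Const_def single_uminus)
  moreover have "Const (a j) * (Const (a i) * G) + Const (- a i) * (Const (a j) * G) = 0"
    by (rule poly_mapping_eqI) (simp add: lookup_add cf_Const_times)
  ultimately show "ell_diff (?B * G) = 0"
    using G ij by (simp add: lower_add lower_Const_times ell_diff_Var_times apolar_def supp_def)
  have "cf (unit_exp j) i \<noteq> cf (unit_exp i) i" using ij(3) by (simp add: lookup_single)
  then have "unit_exp j \<noteq> unit_exp i" by auto
  then have "cf ?B (unit_exp i) = a j"
    by (simp add: lookup_minus cf_Const_times Var_def lookup_single when_def)
  then have "?B \<noteq> 0" using ij(2) by (auto simp: supp_def)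
  then show "?B * G \<noteq> 0" using G by (simp add: apolar_def)
  fix m assume "m \<in> Poly_Mapping.keys (?B * G)"
  then have "cf (Var i * G) m \<noteq> 0 \<or> cf (Var j * G) m \<noteq> 0"
    by (auto simp: in_keys_iff left_diff_distrib lookup_minus mult.assoc cf_Const_times)
  then obtain l m' where l: "l \<in> {i, j}" and m: "m = m' + unit_exp l"
    and m': "m' \<in> Poly_Mapping.keys G"
    by (meson in_keys_iff insertCI keys_Var_times)
  show "mdegree m = Suc b" using G m m' by (simp add: apolar_def mdegree_add)
  show "Poly_Mapping.keys m \<subseteq> {1..n}"
  proof -
    have "Poly_Mapping.keys m' \<subseteq> {1..n}" using G m' by (simp add: apolar_def)
    moreover have "Poly_Mapping.keys m \<subseteq> Poly_Mapping.keys m' \<union> {l}"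
      using Poly_Mapping.keys_add[of m' "unit_exp l"] by (simp add: m)
    moreover have "l \<in> {1..n}" using l ij by (auto simp: supp_def)
    ultimately show ?thesis by blast
  qed
  fix k assume "k \<in> {1..n}"
  then have "cf m' k \<le> (c(i := c i - 1, j := c j - 1)) k" using G m' by (auto simp: apolar_def)
  then show "cf m k \<le> c k"
    using l c ij(3) by (auto simp: m lookup_add lookup_single when_def split: if_splits)
qed

text \<open>
  A product of \<open>b\<close> brackets is a multigraph on \<open>supp\<close> with \<open>b\<close> edges, and \<open>c\<close> bounds the degrees of its
  vertices. The two inequalities are necessary, as an edge uses two units of the total capacity and
  at most one of them at a given vertex. They also suffice: joining the two vertices of largest
  capacity preserves both of them.
\<close>

lemma ex_apolar_brackets:
  assumes "2 * b \<le> (\<Sum>i\<in>supp. c i)" "\<And>i. i \<in> supp \<Longrightarrow> c i + b \<le> (\<Sum>i\<in>supp. c i)"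
  shows "\<exists>G. apolar c b G"
  using assms
proof (induction b arbitrary: c)
  case 0
  then show ?case using apolar_one by blast
next
  case (Suc b)
  let ?s = "\<Sum>i\<in>supp. c i"
  have "supp \<noteq> {}" using Suc.prems(1) by auto
  then obtain i where i: "i \<in> supp" "\<And>k. k \<in> supp \<Longrightarrow> c k \<le> c i"
    using ex_max_on[of supp c] by auto
  have s_i: "?s = c i + (\<Sum>k\<in>supp - {i}. c k)" using i by (simp add: sum.remove)
  then have "(\<Sum>k\<in>supp - {i}. c k) \<noteq> 0" using Suc.prems(2)[OF i(1)] by linarith
  then have "supp - {i} \<noteq> {}" by auto
  then obtain j where j: "j \<in> supp - {i}" "\<And>k. k \<in> supp - {i} \<Longrightarrow> c k \<le> c j"
    using ex_max_on[of "supp - {i}" c] by auto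
  have s_ij: "?s = c i + c j + (\<Sum>k\<in>supp - {i} - {j}. c k)" using s_i j by (simp add: sum.remove)
  have cj: "0 < c j"
  proof (rule ccontr)
    assume "\<not> 0 < c j"
    then have "(\<Sum>k\<in>supp - {i}. c k) = 0" using j(2) by (intro sum.neutral) force
    then show False using \<open>(\<Sum>k\<in>supp - {i}. c k) \<noteq> 0\<close> by simp
  qed
  then have ci: "0 < c i" using i j by (metis DiffD1 less_le_trans)
  define c' where "c' = c(i := c i - 1, j := c j - 1)"
  have "(\<Sum>k\<in>supp. c' k) = c' i + c' j + (\<Sum>k\<in>supp - {i} - {j}. c' k)"
    using i(1) j(1) by (simp add: sum.remove)
  also have "(\<Sum>k\<in>supp - {i} - {j}. c' k) = (\<Sum>k\<in>supp - {i} - {j}. c k)"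
    by (rule sum.cong) (auto simp: c'_def)
  finally have s': "(\<Sum>k\<in>supp. c' k) + 2 = ?s" using s_ij ci cj j(1) by (simp add: c'_def)
  have "\<exists>G. apolar c' b G"
  proof (rule Suc.IH)
    show "2 * b \<le> (\<Sum>k\<in>supp. c' k)" using Suc.prems(1) s' by simp
    fix k assume k: "k \<in> supp"
    show "c' k + b \<le> (\<Sum>k\<in>supp. c' k)"
    \<comment> \<open>A third vertex has at most a third of the total capacity.\<close>
    proof (cases "k = i \<or> k = j")
      case True
      then show ?thesis
        using Suc.prems(2)[OF k] s' ci cj by (auto simp: c'_def)
    next
      case False
      then have "c k \<le> (\<Sum>k\<in>supp - {i} - {j}. c k)"
        using k by (intro member_le_sum) auto
      then have "c k \<le> c j" "c k \<le> c i" "c i + c j + c k \<le> ?s"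
        using i j k False s_ij by auto
      then have "c k + b + 2 \<le> ?s" using Suc.prems(1) by presburger
      then show ?thesis using False s' by (simp add: c'_def)
    qed
  qed
  then show ?case using apolar_bracket_times i(1) j(1) ci cj unfolding c'_def by blast
qed

text \<open>
  Variables outside \<open>supp\<close> are constants for the derivation and fill the remaining degrees.
\<close>

lemma ex_apolar:
  assumes "2 * b \<le> (\<Sum>i\<in>supp. c i)" "\<And>i. i \<in> supp \<Longrightarrow> c i + b \<le> (\<Sum>i\<in>supp. c i)"
    and "r \<le> (\<Sum>i\<in>{1..n} - supp. c i)"
  shows "\<exists>G. apolar c (b + r) G"
  using assms
proof (induction r arbitrary: c)
  case 0
  then show ?case using ex_apolar_brackets by simp
next
  case (Suc r)
  then have "(\<Sum>i\<in>{1..n} - supp. c i) \<noteq> 0" by linarith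
  then obtain t where t: "t \<in> {1..n} - supp" "c t \<noteq> 0"
    by (rule sum.not_neutral_contains_not_neutral)
  define c' where "c' = c(t := c t - 1)"
  have same: "c' i = c i" if "i \<in> supp" for i using that t by (auto simp: c'_def)
  then have same_sum: "(\<Sum>i\<in>supp. c' i) = (\<Sum>i\<in>supp. c i)" by simp
  have "(\<Sum>i\<in>{1..n} - supp - {t}. c' i) = (\<Sum>i\<in>{1..n} - supp - {t}. c i)"
    by (rule sum.cong) (auto simp: c'_def)
  moreover have "(\<Sum>i\<in>{1..n} - supp. c i) = c t + (\<Sum>i\<in>{1..n} - supp - {t}. c i)"
    "(\<Sum>i\<in>{1..n} - supp. c' i) = c' t + (\<Sum>i\<in>{1..n} - supp - {t}. c' i)"
    by (rule sum.remove; use t in simp)+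
  ultimately have "r \<le> (\<Sum>i\<in>{1..n} - supp. c' i)" using Suc.prems(3) by (simp add: c'_def)
  then obtain G where "apolar c' (b + r) G"
    using Suc.IH[of c'] Suc.prems(1,2) same same_sum by auto
  then have "apolar c (Suc (b + r)) (Var t * G)"
    unfolding c'_def using t by (intro apolar_Var_times) auto
  then show ?case by auto
qed

lemma socle_degree_eq: "socle_degree = esupp + (\<Sum>i\<in>{1..n} - supp. d i - 1)"
  using sum_supp_split[of "\<lambda>i. d i - 1"] by (simp add: socle_degree_def esupp_def)

lemma kernel_degree_if_apolar:
  assumes "2 * b \<le> esupp" "\<And>i. i \<in> supp \<Longrightarrow> d i - 1 + b \<le> esupp"
    and "r \<le> socle_degree - esupp"
  shows "kernel_degree (socle_degree - (b + r)) \<and> b + r \<le> socle_degree"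
proof -
  obtain G where G: "apolar (\<lambda>i. d i - 1) (b + r) G"
    using ex_apolar[of b "\<lambda>i. d i - 1" r] assms socle_degree_eq by (auto simp: esupp_def)
  have "m \<in> box" if "m \<in> Poly_Mapping.keys G" for m
  proof -
    have "cf m i < d i" if "i \<in> {1..n}" for i
    proof -
      have "cf m i \<le> d i - 1" using G that \<open>m \<in> Poly_Mapping.keys G\<close> by (simp add: apolar_def)
      then show ?thesis using d_ge_2[OF that] by simp
    qed
    then show ?thesis using G that by (auto simp: apolar_def box_def)
  qed
  then have "box_homogeneous (b + r) G" using G by (simp add: apolar_def box_homogeneous_def)
  then show ?thesis using G kernel_degree_if_ell_diff_eq_0[of G "b + r"] by (simp add: apolar_def)
qed

section \<open>Existence and failure of maximal rank\<close>

text \<open>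
  Two elements of the inverse system have degrees \<open>b + r\<close> and \<open>b + r'\<close>, with \<open>b\<close> brackets each and \<open>r\<close>,
  \<open>r'\<close> variables outside the support, where \<open>s\<close> and \<open>t\<close> are the contributions of the support and of its
  complement to the socle degree. The required sum \<open>s + t + 1\<close> is attainable for \<open>2 b + 2 t \<ge> s + t + 1\<close>,
  and \<open>b = (s + 2 - t) div 2\<close> is the least such natural number; the bracket count then fits the capacities.
\<close>

lemma ex_complementary_degrees:
  fixes s t :: nat
  assumes "1 \<le> t" "2 \<le> t \<or> even s"
  shows "\<exists>b r r'. 2 * b \<le> s \<and> (\<forall>c. c \<le> s \<longrightarrow> 2 * c < s + t \<longrightarrow> c + b \<le> s) \<and>
    r \<le> t \<and> r' \<le> t \<and> (b + r) + (b + r') = s + t + 1"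
proof -
  define b where "b = (s + 2 - t) div 2"
  have "2 * b \<le> s" "s + 1 \<le> 2 * b + t"
    using assms unfolding b_def by presburger+
  moreover have "c + b \<le> s" if "c \<le> s" "2 * c < s + t" for c
    using that unfolding b_def by presburger
  moreover define r where "r = min (s + t + 1 - 2 * b) t"
  moreover define r' where "r' = s + t + 1 - 2 * b - r"
  ultimately have "2 * b \<le> s \<and> (\<forall>c. c \<le> s \<longrightarrow> 2 * c < s + t \<longrightarrow> c + b \<le> s) \<and>
      r \<le> t \<and> r' \<le> t \<and> (b + r) + (b + r') = s + t + 1"
    by (auto simp: min_def)
  then show ?thesis by blast
qed

text \<open>
  Elements of the inverse system of degrees \<open>B\<close> and \<open>B'\<close> with \<open>B + B' = socle_degree + 1\<close> give
  annihilated elements whose degrees have sum \<open>socle_degree - 1\<close>.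
\<close>

lemma not_maximal_rank:
  assumes T: "esupp < socle_degree" "esupp + 2 \<le> socle_degree \<or> odd socle_degree"
    and small: "\<And>i. i \<in> supp \<Longrightarrow> 2 * (d i - 1) < socle_degree"
  shows "\<exists>j. \<not> injective_at j \<and> \<not> surjective_at j"
proof -
  obtain t where t: "socle_degree = esupp + t"
    using T(1) le_Suc_ex[of esupp socle_degree] by auto
  then have "1 \<le> t" "2 \<le> t \<or> even esupp" using T by (cases "t = 1"; simp)+
  then obtain b r r' where b: "2 * b \<le> esupp"
    and bc: "\<And>c. c \<le> esupp \<Longrightarrow> 2 * c < esupp + t \<Longrightarrow> c + b \<le> esupp"
    and r: "r \<le> t" "r' \<le> t" and sum: "(b + r) + (b + r') = esupp + t + 1"
    using ex_complementary_degrees[of t esupp] by blast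
  have bd: "d i - 1 + b \<le> esupp" if i: "i \<in> supp" for i
  proof (rule bc)
    show "d i - 1 \<le> esupp"
      unfolding esupp_def by (rule member_le_sum) (use i in auto)
    show "2 * (d i - 1) < esupp + t" using small[OF i] by (simp only: t)
  qed
  have k: "kernel_degree (socle_degree - (b + r))" "b + r \<le> socle_degree"
    using kernel_degree_if_apolar[OF b bd, of r] r t by simp_all
  have k': "kernel_degree (socle_degree - (b + r'))" "b + r' \<le> socle_degree"
    using kernel_degree_if_apolar[OF b bd, of r'] r t by simp_all
  have "socle_degree - (b + r') + Suc (socle_degree - (b + r)) = socle_degree"
    using k(2) k'(2) sum t by linarith
  then show ?thesis
    using not_injective_at_kernel_degree[OF k(1)] not_surjective_at_kernel_degree[OF k'(1)] by blast
qed

lemma maximal_rank_nearly_full_support: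
  assumes "socle_degree = esupp \<or> (socle_degree = esupp + 1 \<and> even socle_degree)"
  shows "injective_at j \<or> surjective_at j"
proof (cases "2 * j < esupp")
  case True
  then show ?thesis by (simp add: injective_at_low_degree)
next
  case False
  have "x + 2 * (y - x) < 2 * Suc j"
    if "\<not> 2 * j < x" "y = x \<or> y = x + 1 \<and> even y" for x y :: nat
    using that by presburger
  from this[OF False assms] have "esupp + 2 * (socle_degree - esupp) < 2 * Suc j" .
  then show ?thesis by (simp add: surjective_at_high_degree)
qed

lemma maximal_rank_dominant:
  assumes r: "r \<in> {1..n}" "a r \<noteq> 0" "socle_degree \<le> 2 * (d r - 1)"
  shows "injective_at j \<or> surjective_at j"
  using injective_at_dominant[OF r(1,2), of j] surjective_at_dominant[OF r(1,2), of j] r(3)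
  by linarith

section \<open>Comparison with the quotient ring\<close>

abbreviation R :: "'k mpoly ring" where "R \<equiv> poly_ring n"

definition box_ideal :: "'k mpoly set" where "box_ideal = carrier R \<inter> vanishing"

lemma box_subset: "m \<in> box \<Longrightarrow> Poly_Mapping.keys m \<subseteq> {1..n}"
  by (simp add: box_def)

lemma carrier_R_iff: "p \<in> carrier R \<longleftrightarrow> (\<forall>m\<in>Poly_Mapping.keys p. Poly_Mapping.keys m \<subseteq> {1..n})"
  by (simp add: poly_ring_def)

lemma R_simps [simp]:
  "x \<otimes>\<^bsub>R\<^esub> y = x * y" "x \<oplus>\<^bsub>R\<^esub> y = x + y" "\<zero>\<^bsub>R\<^esub> = 0" "\<one>\<^bsub>R\<^esub> = 1"
  by (simp_all add: poly_ring_def)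

lemma ring_R: "ring R"
  using cring_poly_ring by (rule cring.axioms)

lemma carrier_diff: "p \<in> carrier R \<Longrightarrow> q \<in> carrier R \<Longrightarrow> p - q \<in> carrier R"
  using keys_diff[of p q] unfolding carrier_R_iff by (auto simp: in_keys_iff lookup_minus)

lemma carrier_times: "p \<in> carrier R \<Longrightarrow> q \<in> carrier R \<Longrightarrow> p * q \<in> carrier R"
  using ring.ring_simprules(5)[OF ring_R, of p q] by simp

lemma carrier_add: "p \<in> carrier R \<Longrightarrow> q \<in> carrier R \<Longrightarrow> p + q \<in> carrier R"
  using ring.ring_simprules(1)[OF ring_R, of p q] by simp

lemma a_inv_R: "p \<in> carrier R \<Longrightarrow> \<ominus>\<^bsub>R\<^esub> p = - p"
proof (rule abelian_group.minus_equality)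
  show "abelian_group R" using ring_R by (rule ring.is_abelian_group)
  assume "p \<in> carrier R"
  then show "p \<in> carrier R" "- p \<in> carrier R" by (auto simp: carrier_R_iff in_keys_iff)
  show "- p \<oplus>\<^bsub>R\<^esub> p = \<zero>\<^bsub>R\<^esub>" by simp
qed

lemma ideal_box_ideal: "ideal box_ideal R"
proof (rule idealI[OF ring_R])
  have grp: "group (add_monoid R)" using ring.is_abelian_group[OF ring_R] by (rule abelian_group.a_group)
  show "subgroup box_ideal (add_monoid R)"
  proof (rule group.subgroupI[OF grp])
    show "box_ideal \<subseteq> carrier (add_monoid R)" by (auto simp: box_ideal_def)
    have "0 \<in> box_ideal" by (simp add: box_ideal_def carrier_R_iff)
    then show "box_ideal \<noteq> {}" by blast
  next
    fix p assume p: "p \<in> box_ideal"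
    then have "\<ominus>\<^bsub>R\<^esub> p = - p" by (simp add: box_ideal_def a_inv_R)
    moreover have "- p \<in> box_ideal"
      using p by (auto simp: box_ideal_def carrier_R_iff in_keys_iff vanishing_def)
    ultimately show "inv\<^bsub>add_monoid R\<^esub> p \<in> box_ideal" by (simp add: a_inv_def)
  next
    fix p q assume "p \<in> box_ideal" "q \<in> box_ideal"
    then show "p \<otimes>\<^bsub>add_monoid R\<^esub> q \<in> box_ideal"
      by (simp add: box_ideal_def carrier_add vanishing_add)
  qed
next
  fix p q assume "p \<in> box_ideal" "q \<in> carrier R"
  then have "q * p \<in> box_ideal"
    by (simp add: box_ideal_def carrier_times vanishing_times)
  then show "q \<otimes>\<^bsub>R\<^esub> p \<in> box_ideal" "p \<otimes>\<^bsub>R\<^esub> q \<in> box_ideal"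
    by (simp_all add: mult.commute)
qed

lemma Var_power: "Var i ^ k = (mon (Poly_Mapping.single i k) :: 'k mpoly)"
proof (induction k)
  case (Suc k)
  then show ?case by (simp add: Var_def mult_single single_add[symmetric])
qed simp

text \<open>
  A monomial in the variables \<open>x\<^sub>1, \<dots>, x\<^sub>n\<close> outside the box is divisible by some \<open>x\<^sub>i ^ d i\<close>.
\<close>

lemma monomial_ci_eq_box_ideal: "monomial_ci n d = box_ideal"
proof
  let ?S = "(\<lambda>i. Var i ^ d i) ` {1..n} :: 'k mpoly set"
  have S: "?S \<subseteq> box_ideal"
  proof
    fix p assume "p \<in> ?S"
    then obtain i where i: "i \<in> {1..n}" and p: "p = mon (Poly_Mapping.single i (d i))"
      by (auto simp: Var_power)
    have "\<not> cf (Poly_Mapping.single i (d i)) i < d i" by simp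
    then have "Poly_Mapping.single i (d i) \<notin> box" using i unfolding box_def by blast
    then show "p \<in> box_ideal" using i by (simp add: p box_ideal_def mon_vanishing carrier_R_iff)
  qed
  then show "monomial_ci n d \<subseteq> box_ideal"
    unfolding monomial_ci_def by (rule ring.genideal_minimal[OF ring_R ideal_box_ideal])
  have "?S \<subseteq> carrier R" using S by (auto simp: box_ideal_def)
  then have S_sub: "?S \<subseteq> monomial_ci n d" and "ideal (monomial_ci n d) R"
    unfolding monomial_ci_def
    by (rule ring.genideal_self[OF ring_R], rule ring.genideal_ideal[OF ring_R])
  then interpret I: ideal "monomial_ci n d" R by simp
  show "box_ideal \<subseteq> monomial_ci n d"
  proof
    fix p assume p: "p \<in> box_ideal"
    have "Poly_Mapping.single m (cf p m) \<in> monomial_ci n d" if m: "m \<in> Poly_Mapping.keys p" for m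
    proof -
      have sub: "Poly_Mapping.keys m \<subseteq> {1..n}" using p m by (auto simp: box_ideal_def carrier_R_iff)
      have "m \<notin> box" using p m by (auto simp: box_ideal_def vanishing_def in_keys_iff)
      then have "\<not> (\<forall>i\<in>{1..n}. cf m i < d i)" using sub by (simp add: box_def)
      then obtain i where i: "i \<in> {1..n}" "d i \<le> cf m i" by (meson not_le)
      define q where "q = Poly_Mapping.single (m - Poly_Mapping.single i (d i)) (cf p m)"
      have "m - Poly_Mapping.single i (d i) + Poly_Mapping.single i (d i) = m"
        using i by (intro poly_mapping_eqI) (auto simp: lookup_add lookup_minus lookup_single when_def)
      then have q: "q * Var i ^ d i = Poly_Mapping.single m (cf p m)"
        by (simp add: q_def Var_power mult_single)
      have "Poly_Mapping.keys (m - Poly_Mapping.single i (d i)) \<subseteq> Poly_Mapping.keys m"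
        by (auto simp: in_keys_iff lookup_minus)
      then have "q \<in> carrier R" using sub by (auto simp: q_def carrier_R_iff)
      moreover have "(Var i ^ d i :: 'k mpoly) \<in> monomial_ci n d"
        using S_sub i(1) by blast
      ultimately have "q * Var i ^ d i \<in> monomial_ci n d"
        using I.I_l_closed[of "Var i ^ d i" q] by simp
      then show ?thesis by (simp only: q)
    qed
    moreover have sum: "sum f X \<in> monomial_ci n d" if "\<And>x. x \<in> X \<Longrightarrow> f x \<in> monomial_ci n d"
      for X :: "(nat \<Rightarrow>\<^sub>0 nat) set" and f :: "(nat \<Rightarrow>\<^sub>0 nat) \<Rightarrow> 'k mpoly"
      using that
    proof (induction X rule: infinite_finite_induct)
      case (insert x X)
      then show ?case using additive_subgroup.a_closed[OF I.is_additive_subgroup, of "f x" "sum f X"]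
        by simp
    qed (use additive_subgroup.zero_closed[OF I.is_additive_subgroup] in auto)
    ultimately have "(\<Sum>m\<in>Poly_Mapping.keys p. Poly_Mapping.single m (cf p m)) \<in> monomial_ci n d"
      by (intro sum)
    then show "p \<in> monomial_ci n d" by (simp only: sum_monomials)
  qed
qed

lemma coset_eq: "box_ideal +>\<^bsub>R\<^esub> p = {h + p | h. h \<in> box_ideal}"
  by (auto simp: a_r_coset_def')

lemma coset_eq_iff:
  assumes "p \<in> carrier R" "q \<in> carrier R"
  shows "box_ideal +>\<^bsub>R\<^esub> p = box_ideal +>\<^bsub>R\<^esub> q \<longleftrightarrow> p - q \<in> vanishing"
proof
  assume eq: "box_ideal +>\<^bsub>R\<^esub> p = box_ideal +>\<^bsub>R\<^esub> q"
  have "0 + p \<in> box_ideal +>\<^bsub>R\<^esub> p"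
    unfolding coset_eq by (rule CollectI, rule exI[of _ 0]) (simp add: box_ideal_def carrier_R_iff)
  then have "0 + p \<in> box_ideal +>\<^bsub>R\<^esub> q" by (simp only: eq)
  then obtain h where "h \<in> box_ideal" "0 + p = h + q"
    unfolding coset_eq mem_Collect_eq by (elim exE conjE)
  then show "p - q \<in> vanishing" by (simp add: box_ideal_def)
next
  have sub: "box_ideal +>\<^bsub>R\<^esub> p \<subseteq> box_ideal +>\<^bsub>R\<^esub> q"
    if "p - q \<in> vanishing" "p \<in> carrier R" "q \<in> carrier R" for p q
  proof
    fix x assume "x \<in> box_ideal +>\<^bsub>R\<^esub> p"
    then obtain h where h: "h \<in> box_ideal" "x = h + p"
      unfolding coset_eq mem_Collect_eq by (elim exE conjE)
    have "h + (p - q) \<in> box_ideal"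
      using h that by (simp add: box_ideal_def carrier_add carrier_diff vanishing_add)
    moreover have "x = h + (p - q) + q" using h by simp
    ultimately show "x \<in> box_ideal +>\<^bsub>R\<^esub> q" unfolding coset_eq by blast
  qed
  assume "p - q \<in> vanishing"
  moreover from vanishing_diff[OF vanishing_zero this] have "q - p \<in> vanishing" by simp
  ultimately show "box_ideal +>\<^bsub>R\<^esub> p = box_ideal +>\<^bsub>R\<^esub> q"
    using assms sub by (intro equalityI) auto
qed

lemma carrier_sum: "(\<And>x. x \<in> X \<Longrightarrow> f x \<in> carrier R) \<Longrightarrow> sum f X \<in> carrier R"
proof (induction X rule: infinite_finite_induct)
  case (insert x X)
  then show ?case by (simp add: carrier_add)
qed (simp_all add: carrier_R_iff)

lemma ell_in_carrier: "ell \<in> carrier R"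
  unfolding linear_form_def
proof (rule carrier_sum)
  fix i assume "i \<in> {1..n}"
  then show "Const (a i) * Var i \<in> carrier R"
    by (simp add: Const_def Var_def mult_single carrier_R_iff)
qed

lemma mult_coset:
  assumes "p \<in> carrier R"
  shows "(box_ideal +>\<^bsub>R\<^esub> ell) \<otimes>\<^bsub>R Quot box_ideal\<^esub> (box_ideal +>\<^bsub>R\<^esub> p) = box_ideal +>\<^bsub>R\<^esub> (ell * p)"
  using ideal.rcoset_mult_add[OF ideal_box_ideal ell_in_carrier assms] by (simp add: FactRing_def)

lemma homogeneous_polys_carrier: "p \<in> homogeneous_polys n j \<Longrightarrow> p \<in> carrier R"
  by (simp add: homogeneous_polys_def)

lemma box_homogeneous_in_homogeneous_polys:
  "box_homogeneous j f \<Longrightarrow> f \<in> homogeneous_polys n (int j)"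
  by (auto simp: box_homogeneous_def homogeneous_polys_def carrier_R_iff box_def)

lemma zero_in_homogeneous_polys: "(0 :: 'k mpoly) \<in> homogeneous_polys n j"
  by (simp add: homogeneous_polys_def carrier_R_iff)

lemma mdegree_minus_unit_exp:
  assumes "0 < cf m i" shows "Suc (mdegree (m - unit_exp i)) = mdegree m"
  using iffD1[OF unit_exp_add_diff_iff assms] mdegree_add[of "unit_exp i" "m - unit_exp i"] by simp

lemma ell_times_homogeneous:
  assumes "p \<in> homogeneous_polys n j" shows "ell * p \<in> homogeneous_polys n (j + 1)"
proof -
  have "int (mdegree m) = j + 1" if "m \<in> Poly_Mapping.keys (ell * p)" for m
  proof -
    have "(\<Sum>i=1..n. a i * cf (Var i * p) m) \<noteq> 0"
      using that by (simp add: in_keys_iff cf_linear_form_times)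
    then obtain i where "a i * cf (Var i * p) m \<noteq> 0"
      by (rule sum.not_neutral_contains_not_neutral)
    then have pos: "0 < cf m i" and "m - unit_exp i \<in> Poly_Mapping.keys p"
      by (auto simp: cf_Var_times in_keys_iff split: if_splits)
    then have "int (mdegree (m - unit_exp i)) = j" using assms by (simp add: homogeneous_polys_def)
    then show ?thesis using mdegree_minus_unit_exp[OF pos] by linarith
  qed
  then show ?thesis
    using homogeneous_polys_carrier[OF assms] ell_in_carrier carrier_times
    by (simp add: homogeneous_polys_def)
qed

abbreviation mult_ell :: "'k mpoly set \<Rightarrow> 'k mpoly set" where
  "mult_ell \<equiv> \<lambda>u. (box_ideal +>\<^bsub>R\<^esub> ell) \<otimes>\<^bsub>R Quot box_ideal\<^esub> u"

lemma inj_on_mult_ell_iff: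
  "inj_on mult_ell (graded_component n box_ideal (int j)) \<longleftrightarrow> injective_at j"
proof
  assume inj: "inj_on mult_ell (graded_component n box_ideal (int j))"
  show "injective_at j"
    unfolding injective_at_def
  proof (intro allI impI)
    fix f assume f: "box_homogeneous j f" and van: "ell * f \<in> vanishing"
    have hom: "f \<in> homogeneous_polys n (int j)" "(0 :: 'k mpoly) \<in> homogeneous_polys n (int j)"
      using f by (rule box_homogeneous_in_homogeneous_polys) (rule zero_in_homogeneous_polys)
    then have carr: "f \<in> carrier R" "(0 :: 'k mpoly) \<in> carrier R" by (auto dest: homogeneous_polys_carrier)
    then have "ell * f \<in> carrier R" "ell * 0 \<in> carrier R" by (simp_all only: carrier_times ell_in_carrier)
    then have "mult_ell (box_ideal +>\<^bsub>R\<^esub> f) = mult_ell (box_ideal +>\<^bsub>R\<^esub> 0)"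
      using van carr by (simp only: mult_coset coset_eq_iff) simp
    moreover have "box_ideal +>\<^bsub>R\<^esub> f \<in> graded_component n box_ideal (int j)"
      unfolding graded_component_def using hom(1) by (rule imageI)
    moreover have "box_ideal +>\<^bsub>R\<^esub> 0 \<in> graded_component n box_ideal (int j)"
      unfolding graded_component_def using hom(2) by (rule imageI)
    ultimately have "box_ideal +>\<^bsub>R\<^esub> f = box_ideal +>\<^bsub>R\<^esub> 0"
      by (rule inj_onD[OF inj])
    then have "f \<in> vanishing" using carr by (simp add: coset_eq_iff)
    show "f = 0"
    proof (rule poly_mapping_eqI)
      fix m show "cf f m = cf 0 m"
        using f \<open>f \<in> vanishing\<close> unfolding box_homogeneous_def vanishing_def
        by (cases "m \<in> box") (auto simp: in_keys_iff)
    qed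
  qed
next
  assume inj: "injective_at j"
  show "inj_on mult_ell (graded_component n box_ideal (int j))"
  proof (rule inj_onI)
    fix x y assume "x \<in> graded_component n box_ideal (int j)" "y \<in> graded_component n box_ideal (int j)"
    then obtain p q where p: "p \<in> homogeneous_polys n (int j)" "x = box_ideal +>\<^bsub>R\<^esub> p"
      and q: "q \<in> homogeneous_polys n (int j)" "y = box_ideal +>\<^bsub>R\<^esub> q"
      unfolding graded_component_def by (elim imageE)
    have carr: "p \<in> carrier R" "q \<in> carrier R" using p q by (auto dest: homogeneous_polys_carrier)
    assume "mult_ell x = mult_ell y"
    then have "ell * p - ell * q \<in> vanishing"
      using carr by (simp add: p q mult_coset coset_eq_iff carrier_times ell_in_carrier)
    then have van: "ell * (p - q) \<in> vanishing" by (simp add: right_diff_distrib)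
    define f where "f = restrict_to box (p - q)"
    have f: "p - q - f \<in> vanishing" by (simp add: vanishing_def f_def lookup_minus cf_restrict_to)
    then have "ell * (p - q) - ell * (p - q - f) \<in> vanishing"
      using van by (intro vanishing_diff vanishing_times[OF f])
    then have "ell * f \<in> vanishing" by (simp add: algebra_simps)
    moreover have "box_homogeneous j f"
      unfolding box_homogeneous_def
    proof
      fix m assume "m \<in> Poly_Mapping.keys f"
      then have "m \<in> box" "cf p m \<noteq> 0 \<or> cf q m \<noteq> 0"
        by (auto simp: f_def in_keys_iff cf_restrict_to lookup_minus split: if_splits)
      then show "m \<in> box \<and> mdegree m = j"
        using p(1) q(1) by (auto simp: homogeneous_polys_def in_keys_iff)
    qed
    ultimately have "f = 0" using inj by (auto simp: injective_at_def)
    then show "x = y" using f carr by (simp add: p q coset_eq_iff)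
  qed
qed

text \<open>
  A preimage \<open>f\<close> of \<open>g\<close> modulo \<open>vanishing\<close> need neither be homogeneous nor lie in \<open>poly_ring n\<close>. Its part
  of degree \<open>j\<close> in the box is a preimage as well, since \<open>\<ell>\<close> raises degrees by one and monomials outside
  the box stay outside.
\<close>

lemma mult_ell_image_iff:
  "mult_ell ` graded_component n box_ideal (int j) = graded_component n box_ideal (int j + 1)
    \<longleftrightarrow> surjective_at j"
proof
  assume surj: "mult_ell ` graded_component n box_ideal (int j)
    = graded_component n box_ideal (int j + 1)"
  show "surjective_at j"
    unfolding surjective_at_def
  proof (intro ballI impI)
    fix m assume m: "m \<in> box" "mdegree m = Suc j"
    then have hom: "(mon m :: 'k mpoly) \<in> homogeneous_polys n (int j + 1)"
      using box_subset[of m] by (simp add: homogeneous_polys_def carrier_R_iff)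
    then have "box_ideal +>\<^bsub>R\<^esub> mon m \<in> graded_component n box_ideal (int j + 1)"
      unfolding graded_component_def by blast
    then have "box_ideal +>\<^bsub>R\<^esub> mon m \<in> mult_ell ` graded_component n box_ideal (int j)"
      by (simp only: surj)
    then obtain f where f: "f \<in> homogeneous_polys n (int j)"
      and "box_ideal +>\<^bsub>R\<^esub> mon m = mult_ell (box_ideal +>\<^bsub>R\<^esub> f)"
      unfolding graded_component_def by blast
    then have "mon m - ell * f \<in> vanishing"
      using homogeneous_polys_carrier[OF f] homogeneous_polys_carrier[OF hom]
      by (simp add: mult_coset coset_eq_iff carrier_times ell_in_carrier)
    then show "mon m \<in> image_ideal" unfolding image_ideal_def by blast
  qed
next
  assume surj: "surjective_at j"
  have "\<exists>f \<in> homogeneous_polys n (int j). g - ell * f \<in> vanishing"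
    if g: "g \<in> homogeneous_polys n (int j + 1)" for g
  proof -
    have "Poly_Mapping.single m (cf g m) \<in> image_ideal" if m: "m \<in> Poly_Mapping.keys g" for m
    proof (cases "m \<in> box")
      case True
      have "int (mdegree m) = int j + 1" using g m by (simp add: homogeneous_polys_def)
      then have "mon m \<in> image_ideal" using surj True by (simp add: surjective_at_def)
      then have "Const (cf g m) * mon m \<in> image_ideal" by (rule image_ideal_times)
      then show ?thesis by (simp add: Const_def mult_single)
    next
      case False
      then have "Poly_Mapping.single m (cf g m) \<in> vanishing"
        by (auto simp: vanishing_def lookup_single when_def)
      then show ?thesis by (rule vanishing_subset_image_ideal)
    qed
    then have "(\<Sum>m\<in>Poly_Mapping.keys g. Poly_Mapping.single m (cf g m)) \<in> image_ideal"
      by (rule image_ideal_sum)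
    then have "g \<in> image_ideal" by (simp only: sum_monomials)
    then obtain f where f: "g - ell * f \<in> vanishing" unfolding image_ideal_def by blast
    define f' where "f' = restrict_to {m \<in> box. mdegree m = j} f"
    have "box_homogeneous j f'"
      by (auto simp: box_homogeneous_def f'_def in_keys_iff cf_restrict_to split: if_splits)
    moreover have "cf (g - ell * f') m = 0" if m: "m \<in> box" for m
    proof -
      have "cf (ell * f') m = (if mdegree m = Suc j then cf (ell * f) m else 0)"
        unfolding f'_def
      proof (rule cf_ell_times_restrict_to)
        fix i assume pos: "0 < cf m i"
        have "m - unit_exp i \<in> box"
          using m box_add_left[of "unit_exp i" "m - unit_exp i"] iffD1[OF unit_exp_add_diff_iff pos] by simp
        then show "m - unit_exp i \<in> {m \<in> box. mdegree m = j} \<longleftrightarrow> mdegree m = Suc j"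
          using mdegree_minus_unit_exp[OF pos] by auto
      qed
      moreover have "cf g m = 0" if "mdegree m \<noteq> Suc j"
        using g that unfolding homogeneous_polys_def by (force simp: in_keys_iff)
      ultimately show ?thesis using f m by (auto simp: vanishing_def lookup_minus)
    qed
    then have "g - ell * f' \<in> vanishing" by (simp add: vanishing_def)
    ultimately show ?thesis using box_homogeneous_in_homogeneous_polys by blast
  qed
  note preimage = this
  have "box_ideal +>\<^bsub>R\<^esub> g \<in> mult_ell ` graded_component n box_ideal (int j)"
    if g: "g \<in> homogeneous_polys n (int j + 1)" for g
  proof -
    obtain f where f: "f \<in> homogeneous_polys n (int j)" "g - ell * f \<in> vanishing"
      using preimage[OF g] by blast
    have "box_ideal +>\<^bsub>R\<^esub> g = mult_ell (box_ideal +>\<^bsub>R\<^esub> f)"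
      using f homogeneous_polys_carrier[OF f(1)] homogeneous_polys_carrier[OF g]
      by (simp add: mult_coset coset_eq_iff carrier_times ell_in_carrier)
    then show ?thesis using f(1) unfolding graded_component_def by blast
  qed
  then have "graded_component n box_ideal (int j + 1)
      \<subseteq> mult_ell ` graded_component n box_ideal (int j)"
    unfolding graded_component_def[of n box_ideal "int j + 1"] by (rule image_subsetI)
  moreover have "mult_ell (box_ideal +>\<^bsub>R\<^esub> f) \<in> graded_component n box_ideal (int j + 1)"
    if "f \<in> homogeneous_polys n (int j)" for f
    using ell_times_homogeneous[OF that] homogeneous_polys_carrier[OF that]
    unfolding graded_component_def by (simp add: mult_coset)
  then have "mult_ell ` graded_component n box_ideal (int j)
      \<subseteq> graded_component n box_ideal (int j + 1)"
    unfolding graded_component_def[of n box_ideal "int j"] image_image by (rule image_subsetI)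
  ultimately show "mult_ell ` graded_component n box_ideal (int j)
    = graded_component n box_ideal (int j + 1)"
    by (rule equalityI[rotated])
qed

text \<open>
  In negative degrees the component is zero and multiplication is injective, so natural numbers
  suffice as degrees.
\<close>

lemma homogeneous_polys_negative:
  assumes "j < 0" shows "homogeneous_polys n j = {0 :: 'k mpoly}"
proof -
  have "p = 0" if "p \<in> homogeneous_polys n j" for p :: "'k mpoly"
  proof -
    have "int (mdegree m) = j" if "m \<in> Poly_Mapping.keys p" for m
      using \<open>p \<in> homogeneous_polys n j\<close> that by (simp add: homogeneous_polys_def)
    then have "m \<notin> Poly_Mapping.keys p" for m using assms by force
    then show ?thesis by (intro poly_mapping_eqI) (simp add: in_keys_iff)
  qed
  then show ?thesis using zero_in_homogeneous_polys by blast
qed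

lemma lefschetz_element_iff:
  "lefschetz_element n (monomial_ci n d) ell \<longleftrightarrow> (\<forall>j. injective_at j \<or> surjective_at j)"
proof -
  have "lefschetz_element n (monomial_ci n d) ell \<longleftrightarrow>
      (\<forall>j. inj_on mult_ell (graded_component n box_ideal j) \<or>
        mult_ell ` graded_component n box_ideal j = graded_component n box_ideal (j + 1))"
    by (simp add: lefschetz_element_def monomial_ci_eq_box_ideal Let_def)
  also have "\<dots> \<longleftrightarrow> (\<forall>j. inj_on mult_ell (graded_component n box_ideal (int j)) \<or>
        mult_ell ` graded_component n box_ideal (int j) = graded_component n box_ideal (int j + 1))"
  proof (intro iffI allI)
    fix j
    assume nonneg: "\<forall>j. inj_on mult_ell (graded_component n box_ideal (int j)) \<or>
      mult_ell ` graded_component n box_ideal (int j) = graded_component n box_ideal (int j + 1)"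
    show "inj_on mult_ell (graded_component n box_ideal j) \<or>
        mult_ell ` graded_component n box_ideal j = graded_component n box_ideal (j + 1)"
    proof (cases "j < 0")
      case True
      then show ?thesis by (simp add: graded_component_def homogeneous_polys_negative)
    next
      case False
      then show ?thesis using nonneg[rule_format, of "nat j"] by simp
    qed
  qed blast
  finally show ?thesis by (simp only: inj_on_mult_ell_iff mult_ell_image_iff)
qed

end

section \<open>The classification\<close>

(* The "only if" half of (1) fails for n = 2, d 1 = d 2: there x_1 is a Lefschetz element by
   symmetry, although a 2 = 0. This is the only exception, and it is excluded. *)
theorem proposition3p1:
  fixes n e :: nat
    and d :: "nat \<Rightarrow> nat"
    and a :: "nat \<Rightarrow> 'k :: {alg_closed_field, field_char_0}"
  assumes n: "1 \<le> n"
    and d_ge_2: "\<And>i. i \<in> {1..n} \<Longrightarrow> 2 \<le> d i"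
    and d_mono: "\<And>i j. 1 \<le> i \<Longrightarrow> i \<le> j \<Longrightarrow> j \<le> n \<Longrightarrow> d i \<le> d j"
    and e: "e = (\<Sum>i=1..n. d i) - n"
  shows
    "(d n > (e + 1) div 2 \<longrightarrow>
        (a n \<noteq> 0 \<longrightarrow> lefschetz_element n (monomial_ci n d) (linear_form n a)) \<and>
        (lefschetz_element n (monomial_ci n d) (linear_form n a) \<and> \<not> (n = 2 \<and> d 1 = d 2)
           \<longrightarrow> a n \<noteq> 0)) \<and>
     (even e \<and> d n \<le> (e + 1) div 2 \<longrightarrow>
        (lefschetz_element n (monomial_ci n d) (linear_form n a) \<longleftrightarrow>
           card {i \<in> {1..n}. a i = 0} \<le> 1 \<and> (\<forall>j\<in>{1..n}. d j > 2 \<longrightarrow> a j \<noteq> 0))) \<and>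
     (odd e \<and> d n \<le> (e + 1) div 2 \<longrightarrow>
        (lefschetz_element n (monomial_ci n d) (linear_form n a) \<longleftrightarrow>
           (\<Prod>i=1..n. a i) \<noteq> 0))"
proof -
  interpret lefschetz_setting n d a
    by unfold_locales (rule d_ge_2)
  let ?lef = "lefschetz_element n (monomial_ci n d) (linear_form n a)"
  define T where "T = {i \<in> {1..n}. a i = 0}"
  have T: "finite T" "{1..n} - supp = T" by (auto simp: T_def supp_def)
  have n_in: "n \<in> {1..n}" using n by simp
  have e_socle: "e = socle_degree"
  proof -
    have "(\<Sum>i=1..n. d i) = (\<Sum>i=1..n. (d i - 1) + 1)"
      using d_ge_2 by (intro sum.cong) force+
    also have "\<dots> = socle_degree + n" unfolding socle_degree_def sum.distrib by simp
    finally show ?thesis using e by simp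
  qed
  have e_split: "e = esupp + (\<Sum>i\<in>T. d i - 1)"
    by (simp only: e_socle socle_degree_eq T(2))
  have lef: ?lef if "e = esupp \<or> (e = esupp + 1 \<and> even e)"
    using that maximal_rank_nearly_full_support unfolding lefschetz_element_iff e_socle by blast
  have not_lef: "\<not> ?lef" if "esupp < e" "esupp + 2 \<le> e \<or> odd e"
    "\<And>i. i \<in> supp \<Longrightarrow> 2 * (d i - 1) < e"
    using that not_maximal_rank unfolding lefschetz_element_iff e_socle by blast
  have small: "2 * (d i - 1) < e" if "d n \<le> (e + 1) div 2" "i \<in> supp" for i
  proof -
    have "d i \<le> d n" using that(2) by (intro d_mono) (auto simp: supp_def)
    moreover have "2 \<le> d i" using that(2) by (intro d_ge_2) (auto simp: supp_def)
    moreover have "2 * (x - 1) < e" if "x \<le> y" "y \<le> (e + 1) div 2" "2 \<le> x" for x y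
      using that by presburger
    ultimately show ?thesis using that(1) by blast
  qed
  have ge_1: "1 \<le> d i - 1" if "i \<in> {1..n}" for i using d_ge_2[OF that] by simp
  have card_le: "card T \<le> (\<Sum>i\<in>T. d i - 1)"
    using sum_mono[of T "\<lambda>_. 1" "\<lambda>i. d i - 1"] ge_1 by (simp add: T_def)

  have dominant: "a n \<noteq> 0 \<Longrightarrow> ?lef" "?lef \<Longrightarrow> \<not> (n = 2 \<and> d 1 = d 2) \<Longrightarrow> a n \<noteq> 0"
    if dom: "(e + 1) div 2 < d n"
  proof -
    have "e \<le> 2 * (x - 1)" if "(e + 1) div 2 < x" for x using that by presburger
    then have dn: "e \<le> 2 * (d n - 1)" using dom by blast
    show ?lef if "a n \<noteq> 0"
      using maximal_rank_dominant[OF n_in that] dn unfolding lefschetz_element_iff e_socle by blast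
    assume lef: ?lef and not_exceptional: "\<not> (n = 2 \<and> d 1 = d 2)"
    show "a n \<noteq> 0"
    proof
      assume "a n = 0"
      then have nT: "n \<in> T" using n_in by (simp add: T_def)
      have le: "d n - 1 \<le> (\<Sum>i\<in>T. d i - 1)"
        by (rule member_le_sum) (use nT T in auto)
      \<comment> \<open>If \<open>2 (d i - 1) \<ge> e\<close>, then \<open>i\<close> and \<open>n\<close> exhaust the socle degree: there are
        just two variables, with equal exponents.\<close>
      have small: "2 * (d i - 1) < e" if i: "i \<in> supp" for i
      proof (rule ccontr)
        assume "\<not> 2 * (d i - 1) < e"
        have i_in: "i \<in> {1..n}" "i \<noteq> n" using i nT by (auto simp: supp_def T_def)
        define rest where "rest = (\<Sum>l\<in>{1..n} - {i} - {n}. d l - 1)"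
        have "e = (d i - 1) + (\<Sum>l\<in>{1..n} - {i}. d l - 1)"
          unfolding e_socle socle_degree_def by (rule sum.remove) (use i_in in auto)
        also have "(\<Sum>l\<in>{1..n} - {i}. d l - 1) = (d n - 1) + rest"
          unfolding rest_def by (rule sum.remove) (use i_in n_in in auto)
        finally have "e = (d i - 1) + ((d n - 1) + rest)" .
        moreover have "x = y \<and> z = 0" if "\<not> 2 * x < e" "e \<le> 2 * y" "e = x + (y + z)" for x y z
          using that by linarith
        ultimately have eq: "d i - 1 = d n - 1" "rest = 0"
          using \<open>\<not> 2 * (d i - 1) < e\<close> dn by blast+
        have "{1..n} - {i} - {n} = {}"
        proof (rule ccontr)
          assume "{1..n} - {i} - {n} \<noteq> {}"
          then obtain l where l: "l \<in> {1..n} - {i} - {n}" by blast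
          then have "d l - 1 \<le> rest" unfolding rest_def by (intro member_le_sum) auto
          then show False using ge_1[of l] l eq(2) by simp
        qed
        then have "{1..n} = {i, n}" using i_in n_in by blast
        then have "card {1..n} = 2" using i_in by simp
        then have "n = 2" by simp
        then have "i = 1" using i_in by auto
        then show False
          using not_exceptional eq(1) \<open>n = 2\<close> d_ge_2[of 1] d_ge_2[of 2] by simp
      qed
      have "esupp < e" using e_split le ge_1[OF n_in] by linarith
      \<comment> \<open>Otherwise \<open>d n = 2\<close> and \<open>e = 2\<close>, and the bound \<open>small\<close> fails for the other index.\<close>
      moreover have "esupp + 2 \<le> e \<or> odd e"
      proof (rule ccontr)
        assume contr: "\<not> (esupp + 2 \<le> e \<or> odd e)"
        then have "d n - 1 = 1" using e_split le ge_1[OF n_in] by linarith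
        then have "e \<le> 2" using dn by simp
        moreover have "e \<noteq> 0" "e \<noteq> 1" using contr \<open>esupp < e\<close> by auto
        ultimately have "e = 2" by linarith
        then have "esupp = 1" using contr e_split le ge_1[OF n_in] by linarith
        then have "supp \<noteq> {}" by (auto simp: esupp_def)
        then obtain i where i: "i \<in> supp" by blast
        then have "1 \<le> d i - 1" by (intro ge_1) (auto simp: supp_def)
        then show False using small[OF i] \<open>e = 2\<close> by linarith
      qed
      ultimately show False using not_lef small lef by blast
    qed
  qed

  have even_case: "?lef \<longleftrightarrow> card T \<le> 1 \<and> (\<forall>j\<in>{1..n}. d j > 2 \<longrightarrow> a j \<noteq> 0)"
    if "even e" "d n \<le> (e + 1) div 2"
  proof
    assume lef: ?lef
    have "(\<Sum>i\<in>T. d i - 1) \<le> 1"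
    proof (rule ccontr)
      assume "\<not> (\<Sum>i\<in>T. d i - 1) \<le> 1"
      then have "esupp < e" "esupp + 2 \<le> e \<or> odd e" using e_split by linarith+
      then show False using not_lef small[OF that(2)] lef by blast
    qed
    moreover have "d j - 1 \<le> (\<Sum>i\<in>T. d i - 1)" if "j \<in> T" for j
      by (rule member_le_sum) (use that T in auto)
    ultimately show "card T \<le> 1 \<and> (\<forall>j\<in>{1..n}. d j > 2 \<longrightarrow> a j \<noteq> 0)"
      using card_le by (fastforce simp: T_def)
  next
    assume asm: "card T \<le> 1 \<and> (\<forall>j\<in>{1..n}. d j > 2 \<longrightarrow> a j \<noteq> 0)"
    have "d i - 1 = 1" if "i \<in> T" for i
      using asm that ge_1[of i] by (force simp: T_def)
    then have "(\<Sum>i\<in>T. d i - 1) = card T" by simp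
    then have "e = esupp \<or> e = esupp + 1" using asm e_split by linarith
    then show ?lef using lef that(1) by blast
  qed

  have odd_case: "?lef \<longleftrightarrow> (\<Prod>i=1..n. a i) \<noteq> 0" if "odd e" "d n \<le> (e + 1) div 2"
  proof -
    have prod: "(\<Prod>i=1..n. a i) \<noteq> 0 \<longleftrightarrow> T = {}" by (auto simp: T_def)
    show ?thesis
    proof (cases "T = {}")
      case True
      then show ?thesis using lef e_split prod by simp
    next
      case False
      then have "1 \<le> card T" using T(1) by (simp add: Suc_le_eq card_gt_0_iff)
      then have "esupp < e" using card_le e_split by linarith
      then show ?thesis using not_lef[OF _ _ small[OF that(2)]] that(1) prod False by blast
    qed
  qed

  show ?thesis using dominant even_case odd_case unfolding T_def by blast
qed

end
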